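(* Let $\beta\ge 0$, $q\in\mathbb{N}$ and $x\in(0,\infty)$. For each function $f\in E[0,\infty)$ which admits the derivative $f^{(2q)}(x)$ at the point $x$, the operators $P_n^\beta$ possess the asymptotic expansion $$\left(P_n^\beta f\right)(x)=f(x)+\sum_{k=1}^{q}\frac{1}{n^k}c_k^\beta(f,x)+o\left(n^{-q}\right)\qquad(n\to\infty),$$ where the coefficients $c_k^\beta(f,x)$ (independent of $n$) are given by $$c_k^\beta(f,x)=\sum_{s=k}^{2k}\frac{f^{(s)}(x)}{s!}x^s\sum_{j=0}^{k}a(k,s,j)\frac{(\beta x)^j}{j!}.$$
   Context: For $A>0$, $E_A[0,\infty)$ denotes the space of all locally integrable functions $f$ on $[0,\infty)$ for which there is a constant $C>0$ with $|f(t)|\le Ce^{At}$ for all $t\ge 0$; $E[0,\infty)=\bigcup_{A>0}E_A[0,\infty)$. For a fixed real $\beta\ge 0$ and $n\in\mathbb{N}$ (positive integers), the semi-exponential Post--Widder operators are defined, for $x>0$, by $$\left(P_n^\beta f\right)(x)=e^{-\beta x}\left(\frac{n}{x}\right)^n\sum_{\nu=0}^{\infty}\frac{(n\beta)^\nu}{\nu!}\frac{1}{\Gamma(n+\nu)}\int_0^\infty t^{n+\nu-1}e^{-nt/x}f(t)\,dt .$$ For $f\in E_A[0,\infty)$ the value $(P_n^\beta f)(x)$ is well-defined for $n>Ax$, hence for all sufficiently large $n$. Convention: $0^0=1$. For $z\in\mathbb{R}$ and $m\in\mathbb{N}_0$, $\binom{z}{m}=z(z-1)\cdots(z-m+1)/m!$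 (so $\binom{z}{0}=1$, and in particular $\binom{-1}{0}=1$). The (unsigned) associated Stirling numbers of the first kind $s_2(i,j)$ ($i,j\ge 0$) are defined by the double generating function $$\sum_{i,j=0}^{\infty}s_2(i,j)\frac{t^i}{i!}u^j=e^{-tu}(1-t)^{-u}.$$ For integers $k,s,j\ge 0$ (used here only with $k\le s\le 2k$), $$a(k,s,j)=\sum_{i=j}^{\min\{k,2k-s\}}\binom{i-1}{i-j}\frac{s!}{(s-i)!}s_2(s-i,s-k),$$ where a sum is read as zero if its lower index exceeds its upper index. *)

theory Defs
  imports
    "HOL-Analysis.Analysis"
    "HOL-Computational_Algebra.Computational_Algebra"
    "HOL-Library.Landau_Symbols"
begin

definition locally_integrable :: "(real \<Rightarrow> real) \<Rightarrow> bool" where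
  "locally_integrable f \<longleftrightarrow> (\<forall>b\<ge>0. set_integrable lebesgue {0..b} f)"

text \<open>Functions on \<open>[0,\<infinity>)\<close> are represented by functions on \<open>\<real>\<close> whose values at negative
  arguments are irrelevant.\<close>

definition exp_space_of :: "real \<Rightarrow> (real \<Rightarrow> real) set" where
  "exp_space_of A = {f. locally_integrable f \<and> (\<exists>C>0. \<forall>t\<ge>0. \<bar>f t\<bar> \<le> C * exp (A * t))}"

definition exp_space :: "(real \<Rightarrow> real) set" where
  "exp_space = (\<Union>A\<in>{0<..}. exp_space_of A)"

text \<open>\<open>f\<close> admits an \<open>n\<close>-th derivative at the single point \<open>x\<close>: the derivative of order \<open>n - 1\<close>
  exists in a whole neighbourhood of \<open>x\<close> and is differentiable at \<open>x\<close>.  Under this condition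
  \<open>(deriv ^^ s) f x\<close> is the genuine \<open>s\<close>-th derivative for every \<open>s \<le> n\<close>.\<close>

primrec has_nth_derivative_at :: "nat \<Rightarrow> (real \<Rightarrow> real) \<Rightarrow> real \<Rightarrow> bool" where
  "has_nth_derivative_at 0 f x \<longleftrightarrow> True"
| "has_nth_derivative_at (Suc n) f x \<longleftrightarrow>
     (\<forall>\<^sub>F y in nhds x. has_nth_derivative_at n f y) \<and> (deriv ^^ n) f differentiable (at x)"

definition post_widder :: "real \<Rightarrow> nat \<Rightarrow> (real \<Rightarrow> real) \<Rightarrow> real \<Rightarrow> real" where
  "post_widder \<beta> n f x =
     exp (- \<beta> * x) * (real n / x) ^ n *
     (\<Sum>\<nu>. (real n * \<beta>) ^ \<nu> / fact \<nu> * (1 / Gamma (real (n + \<nu>))) *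
        (LINT t:{0..}|lebesgue. t ^ (n + \<nu> - 1) * exp (- real n * t / x) * f t))"

text \<open>The double generating function \<open>e\<^bsup>-tu\<^esup> (1 - t)\<^bsup>-u\<^esup>\<close>, as a formal power series in \<open>t\<close> whose
  coefficients are polynomials in \<open>u = [:0, 1:]\<close>: the first factor is the exponential series,
  the second the binomial series \<open>(1 - t)\<^bsup>-u\<^esup> = \<Sum>i. u (u + 1) \<dots> (u + i - 1) t\<^sup>i / i!\<close>.\<close>

definition stirling2_gf :: "real poly fps" where
  "stirling2_gf =
     Abs_fps (\<lambda>i. smult (1 / fact i) ((- [:0, 1:]) ^ i)) *
     Abs_fps (\<lambda>i. smult (1 / fact i) (pochhammer [:0, 1:] i))"

definition s2 :: "nat \<Rightarrow> nat \<Rightarrow> real" where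
  "s2 i j = fact i * coeff (fps_nth stirling2_gf i) j"

text \<open>The formal definition agrees with the analytic identity: the double series converges
  absolutely to \<open>e\<^bsup>-tu\<^esup> (1 - t)\<^bsup>-u\<^esup>\<close> for all real \<open>u\<close> and \<open>\<bar>t\<bar> < 1\<close>.\<close>

definition coeff_dom :: "real poly \<Rightarrow> real poly \<Rightarrow> bool" where
  "coeff_dom p q \<longleftrightarrow> (\<forall>j. \<bar>coeff p j\<bar> \<le> coeff q j)"

lemma coeff_dom_mult:
  assumes "coeff_dom p P" "coeff_dom q Q"
  shows "coeff_dom (p * q) (P * Q)"
  unfolding coeff_dom_def
proof
  fix j
  have "\<bar>coeff (p * q) j\<bar> \<le> (\<Sum>i\<le>j. \<bar>coeff p i * coeff q (j - i)\<bar>)"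
    unfolding coeff_mult by (rule sum_abs)
  also have "\<dots> \<le> (\<Sum>i\<le>j. coeff P i * coeff Q (j - i))"
  proof (rule sum_mono)
    fix i
    have "\<bar>coeff p i\<bar> \<le> coeff P i" "\<bar>coeff q (j - i)\<bar> \<le> coeff Q (j - i)"
      using assms by (auto simp: coeff_dom_def)
    thus "\<bar>coeff p i * coeff q (j - i)\<bar> \<le> coeff P i * coeff Q (j - i)"
      unfolding abs_mult by (intro mult_mono) auto
  qed
  finally show "\<bar>coeff (p * q) j\<bar> \<le> coeff (P * Q) j"
    by (simp add: coeff_mult)
qed

lemma coeff_dom_sum:
  assumes "\<And>i. i \<in> A \<Longrightarrow> coeff_dom (p i) (P i)"
  shows "coeff_dom (\<Sum>i\<in>A. p i) (\<Sum>i\<in>A. P i)"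
  unfolding coeff_dom_def coeff_sum
  using assms by (auto simp: coeff_dom_def intro!: order_trans[OF sum_abs] sum_mono)

lemma coeff_dom_smult: "coeff_dom p P \<Longrightarrow> c \<ge> 0 \<Longrightarrow> coeff_dom (smult c p) (smult c P)"
  by (auto simp: coeff_dom_def abs_mult intro!: mult_left_mono)

lemma coeff_dom_power: "coeff_dom p P \<Longrightarrow> coeff_dom (p ^ n) (P ^ n)"
  by (induction n) (simp_all add: coeff_dom_mult, simp add: coeff_dom_def coeff_1)

lemma coeff_dom_pochhammer: "coeff_dom (pochhammer [:0, 1:] n) (pochhammer [:0, 1:] n)"
proof (induction n)
  case 0
  show ?case by (simp add: coeff_dom_def coeff_1)
next
  case (Suc n)
  have "coeff_dom ([:0, 1:] + of_nat n) ([:0, 1:] + of_nat n)"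
    by (auto simp: coeff_dom_def of_nat_poly coeff_pCons split: nat.splits)
  with Suc show ?case by (simp only: pochhammer_Suc) (rule coeff_dom_mult)
qed

lemma poly_pochhammer: "poly (pochhammer p n) (u :: real) = pochhammer (poly p u) n"
  by (induction n) (simp_all add: pochhammer_Suc)

lemma fps_nth_stirling2_gf:
  "fps_nth stirling2_gf i = (\<Sum>a\<le>i. smult (1 / fact a) ((- [:0, 1:]) ^ a) *
     smult (1 / fact (i - a)) (pochhammer [:0, 1:] (i - a)))"
  by (simp add: stirling2_gf_def fps_mult_nth atLeast0AtMost)

lemma binomial_series_sums:
  assumes "\<bar>t\<bar> < 1"
  shows "(\<lambda>i. pochhammer u i / fact i * t ^ i) sums ((1 - t) powr (-u :: real))"
proof -
  have "(\<lambda>i. (-u gchoose i) * (-t) ^ i) sums ((1 + (-t)) powr (-u))"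
    by (rule gen_binomial_real) (use assms in auto)
  moreover have "(-u gchoose i) * (-t) ^ i = pochhammer u i / fact i * t ^ i" for i
    by (simp add: gbinomial_pochhammer flip: power_mult_distrib)
  ultimately show ?thesis by simp
qed

lemma gf_product_sums:
  assumes "\<bar>t\<bar> < 1"
  shows "(\<lambda>i. (\<Sum>a\<le>i. v ^ a / fact a * (pochhammer u (i - a) / fact (i - a))) * t ^ i)
           sums (exp (t * v) * (1 - t) powr (-u :: real))"
proof -
  define E where "E = (\<lambda>i. (t * v) ^ i / fact i)"
  define B where "B = (\<lambda>i. pochhammer u i / fact i * t ^ i)"
  have E: "E sums exp (t * v)"
    using exp_converges[of "t * v"] by (simp add: E_def field_simps)
  have nE: "summable (\<lambda>i. norm (E i))"
    using summable_norm_exp[of "t * v"] by (simp add: E_def field_simps)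
  have B: "B sums ((1 - t) powr (-u))"
    unfolding B_def by (rule binomial_series_sums) fact
  have nB: "summable (\<lambda>i. norm (B i))"
  proof -
    define r where "r = (1 + \<bar>t\<bar>) / 2"
    have r: "\<bar>r\<bar> < 1" "\<bar>t\<bar> < \<bar>r\<bar>" using assms by (auto simp: r_def field_simps)
    have "summable (\<lambda>i. pochhammer u i / fact i * r ^ i)"
      using binomial_series_sums[OF r(1)] by (rule sums_summable)
    thus ?thesis unfolding B_def
      by (rule powser_insidea) (use r in auto)
  qed
  have eq: "(\<Sum>a\<le>i. E a * B (i - a)) =
      (\<Sum>a\<le>i. v ^ a / fact a * (pochhammer u (i - a) / fact (i - a))) * t ^ i" for i
    unfolding sum_distrib_right
  proof (rule sum.cong)
    fix a assume "a \<in> {..i}"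
    hence "t ^ i = t ^ a * t ^ (i - a)" by (simp flip: power_add)
    thus "E a * B (i - a) = v ^ a / fact a * (pochhammer u (i - a) / fact (i - a)) * t ^ i"
      by (simp add: E_def B_def power_mult_distrib)
  qed auto
  show "(\<lambda>i. (\<Sum>a\<le>i. v ^ a / fact a * (pochhammer u (i - a) / fact (i - a))) * t ^ i)
          sums (exp (t * v) * (1 - t) powr (-u))"
    using Cauchy_product_sums[OF nE nB] sums_unique[OF E] sums_unique[OF B] by (simp add: eq)
qed

theorem s2_double_generating_function:
  fixes t u :: real
  assumes "\<bar>t\<bar> < 1"
  shows "((\<lambda>(i, j). s2 i j * (t ^ i / fact i) * u ^ j) has_sum
            (exp (- t * u) * (1 - t) powr (- u))) UNIV"
proof -
  define p where "p = fps_nth stirling2_gf"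
  define P :: "nat \<Rightarrow> real poly" where
    "P = (\<lambda>i. \<Sum>a\<le>i. smult (1 / fact a) ([:0, 1:] ^ a) *
       smult (1 / fact (i - a)) (pochhammer [:0, 1:] (i - a)))"
  define f where "f = (\<lambda>(i, j). coeff (p i) j * t ^ i * u ^ j)"
  define g where "g = (\<lambda>(i, j). coeff (P i) j * \<bar>t\<bar> ^ i * \<bar>u\<bar> ^ j)"
  have dom: "coeff_dom (p i) (P i)" for i
    unfolding p_def P_def fps_nth_stirling2_gf
    by (intro coeff_dom_sum coeff_dom_mult coeff_dom_smult coeff_dom_power coeff_dom_pochhammer)
       (auto simp: coeff_dom_def coeff_pCons split: nat.splits)
  have P_nonneg: "coeff (P i) j \<ge> 0" for i j
    using dom[of i] unfolding coeff_dom_def by (meson abs_ge_zero order_trans)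
  have poly_has_sum: "((\<lambda>j. coeff q j * c * v ^ j) has_sum (poly q v * c)) UNIV"
    for q :: "real poly" and c v :: real
    by (rule has_sum_finite_neutralI[where B = "{..degree q}"])
       (auto simp: coeff_eq_0 poly_altdef sum_distrib_left mult_ac)
  have P_sums: "(\<lambda>i. poly (P i) \<bar>u\<bar> * \<bar>t\<bar> ^ i) sums
                  (exp (\<bar>t\<bar> * \<bar>u\<bar>) * (1 - \<bar>t\<bar>) powr (- \<bar>u\<bar>))"
    using gf_product_sums[of "\<bar>t\<bar>" "\<bar>u\<bar>" "\<bar>u\<bar>"] assms
    by (simp add: P_def poly_sum poly_pochhammer mult_ac)
  have p_sums: "(\<lambda>i. poly (p i) u * t ^ i) sums (exp (- t * u) * (1 - t) powr (- u))"
    using gf_product_sums[of t "-u" u] assms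
    by (simp add: p_def fps_nth_stirling2_gf poly_sum poly_pochhammer mult_ac)
  have "poly (P i) \<bar>u\<bar> \<ge> 0" for i
    by (auto simp: poly_altdef intro!: sum_nonneg mult_nonneg_nonneg P_nonneg)
  hence P_summable: "(\<lambda>i. poly (P i) \<bar>u\<bar> * \<bar>t\<bar> ^ i) summable_on UNIV"
    using P_sums by (auto simp: summable_on_UNIV_nonneg_real_iff sums_iff)
  have "g summable_on Sigma UNIV (\<lambda>_. UNIV)"
    by (rule summable_on_SigmaI[where g = "\<lambda>i. poly (P i) \<bar>u\<bar> * \<bar>t\<bar> ^ i"])
       (use poly_has_sum P_summable P_nonneg in \<open>auto simp: g_def\<close>)
  moreover have "norm (f ij) \<le> g ij" for ij
    using dom unfolding f_def g_def coeff_dom_def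
    by (auto simp: abs_mult power_abs split: prod.splits intro!: mult_right_mono)
  ultimately have "(\<lambda>ij. norm (f ij)) summable_on Sigma UNIV (\<lambda>_. UNIV)"
    by (rule summable_on_comparison_test) auto
  hence f_summable: "f summable_on UNIV"
    using abs_summable_summable[of f UNIV] by simp
  hence "(f has_sum infsum f UNIV) (Sigma UNIV (\<lambda>_. UNIV))"
    by simp
  hence "((\<lambda>i. poly (p i) u * t ^ i) has_sum infsum f UNIV) UNIV"
    by (rule has_sum_SigmaD) (simp only: f_def prod.case, rule poly_has_sum)
  hence "infsum f UNIV = exp (- t * u) * (1 - t) powr (- u)"
    using p_sums by (intro sums_unique2[OF has_sum_imp_sums])
  moreover have "f = (\<lambda>(i, j). s2 i j * (t ^ i / fact i) * u ^ j)"
    by (auto simp: f_def p_def s2_def fun_eq_iff)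
  ultimately show ?thesis
    using has_sum_infsum[OF f_summable] by simp
qed

definition a_coeff :: "nat \<Rightarrow> nat \<Rightarrow> nat \<Rightarrow> real" where
  "a_coeff k s j =
     (\<Sum>i\<in>{j..min k (2 * k - s)}.
        ((real i - 1) gchoose (i - j)) * (fact s / fact (s - i)) * s2 (s - i) (s - k))"

definition c_coeff :: "real \<Rightarrow> nat \<Rightarrow> (real \<Rightarrow> real) \<Rightarrow> real \<Rightarrow> real" where
  "c_coeff \<beta> k f x =
     (\<Sum>s = k..2 * k. (deriv ^^ s) f x / fact s * x ^ s *
        (\<Sum>j = 0..k. a_coeff k s j * ((\<beta> * x) ^ j / fact j)))"

end

theory Submission
  imports Defs "HOL-Probability.Distributions"
begin

text \<open>
  The operator is an expectation. Let \<open>\<nu>\<close> be Poisson distributed with mean \<open>\<beta>x\<close> and, given \<open>\<nu>\<close>,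
  let \<open>T\<close> have the gamma distribution of shape \<open>n + \<nu>\<close> and rate \<open>n/x\<close>. Absorbing the factor
  \<open>(n/x)\<^sup>n\<close> into the gamma densities shows that the value of the operator at \<open>f\<close> and \<open>x\<close> is the
  mean of \<open>f T\<close> (lemma \<open>post_widder_sums\<close>). So it is linear and monotone in \<open>f\<close>, and it
  concentrates at \<open>x\<close> as \<open>n\<close> grows. The expansion arises from replacing \<open>f\<close> by its Taylor
  polynomial at \<open>x\<close>, whose mean is a finite combination of the central moments of \<open>T\<close>.

  These moments are known exactly. With \<open>y = \<lambda>x/n\<close>, the mean of \<open>exp (\<lambda>(T - x))\<close> is
  \<open>e\<^bsup>-ny\<^esup> (1 - y)\<^bsup>-n\<^esup> \<sqdot> exp (\<beta>x y/(1 - y))\<close>. The first factor is the generating function of the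
  associated Stirling numbers at \<open>u = n\<close>, and the coefficient of \<open>y\<^sup>i\<close> in the second one is
  \<open>\<Sum>j. binom(i-1, i-j) (\<beta>x)\<^sup>j/j!\<close>. Sorting the product by powers of \<open>n\<close> yields the numbers
  \<open>a_coeff k s j\<close> (lemma \<open>post_widder_central_moment\<close>). The argument below follows this computation
  coefficientwise, with formal power series for the gamma part and factorial moments for the Poisson
  part, so that no series in \<open>\<lambda>\<close> has to be interchanged with an integral.

  The order of magnitude comes from \<open>e\<^bsup>-tu\<^esup> (1 - t)\<^bsup>-u\<^esup> = exp (u (t\<^sup>2/2 + t\<^sup>3/3 + \<dots>))\<close>: every factor
  \<open>u\<close> comes with at least two factors \<open>t\<close>, so \<open>s2 i j = 0\<close> for \<open>2j > i\<close> (lemma \<open>s2_eq_0\<close>). Hence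
  the central moment of order \<open>s\<close> is \<open>O(n\<^bsup>-\<lceil>s/2\<rceil>\<^esup>)\<close>. In particular order \<open>2q\<close> contributes
  \<open>O(n\<^bsup>-q\<^esup>)\<close>, and the coefficients of \<open>n\<^bsup>-k\<^esup>\<close> with \<open>k \<le> q\<close> use derivatives of order at most \<open>2q\<close>.

  It remains to bound the mean of the Taylor remainder \<open>R\<close>. Near \<open>x\<close>, Peano's form of Taylor's theorem
  gives \<open>\<bar>R t\<bar> \<le> \<epsilon> (t - x)\<^bsup>2q\<^esup>\<close>, with mean \<open>\<epsilon> O(n\<^bsup>-q\<^esup>)\<close>. Away from \<open>x\<close> the only information is
  \<open>\<bar>R t\<bar> \<le> C e\<^bsup>At\<^esup>\<close>. There the elementary inequality \<open>E \<le> E\<^sup>2/N + N\<close> with \<open>N = n\<^bsup>q+1\<^esup>\<close> separates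
  the exponential, whose square has bounded mean, from the event \<open>\<bar>T - x\<bar> \<ge> \<delta>\<close>, whose probability is
  \<open>O(n\<^bsup>-2q-2\<^esup>)\<close> by the moment of order \<open>4q + 4\<close>. Both contributions are \<open>O(n\<^bsup>-q-1\<^esup>)\<close>
  (lemma \<open>post_widder_remainder\<close>).
\<close>

section \<open>Functions of exponential growth\<close>

text \<open>
  Local integrability speaks of bounded intervals only; the product with the indicator of the half
  line is the pointwise limit of the products with the indicators of \<open>[0,k]\<close>.
\<close>
lemma exp_space_of_measurable:
  assumes "f \<in> exp_space_of A"
  shows "set_borel_measurable lebesgue {0..} f"
  unfolding set_borel_measurable_def
proof (rule borel_measurable_LIMSEQ_real)
  fix t :: real
  have "\<forall>\<^sub>F k in sequentially. indicator {0..real k} t *\<^sub>R f t = indicator {0..} t *\<^sub>R f t"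
    using eventually_ge_at_top[of "nat \<lceil>t\<rceil>"] by eventually_elim (auto simp: indicator_def)
  thus "(\<lambda>k. indicator {0..real k} t *\<^sub>R f t) \<longlonglongrightarrow> indicator {0..} t *\<^sub>R f t"
    by (rule tendsto_eventually)
next
  fix k :: nat
  have "set_integrable lebesgue {0..real k} f"
    using assms by (auto simp: exp_space_of_def locally_integrable_def)
  thus "(\<lambda>t. indicator {0..real k} t *\<^sub>R f t) \<in> borel_measurable lebesgue"
    unfolding set_integrable_def by (rule borel_measurable_integrable)
qed

lemma exp_space_ofE:
  assumes "f \<in> exp_space_of A"
  obtains C where "C > 0" "\<And>t. t \<ge> 0 \<Longrightarrow> \<bar>f t\<bar> \<le> C * exp (A * t)"
  using assms unfolding exp_space_of_def by auto

lemma exp_space_of_mono: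
  assumes "f \<in> exp_space_of A" "A \<le> B"
  shows "f \<in> exp_space_of B"
proof -
  obtain C where C: "C > 0" "\<And>t. t \<ge> 0 \<Longrightarrow> \<bar>f t\<bar> \<le> C * exp (A * t)"
    using assms(1) by (rule exp_space_ofE) blast
  have "\<bar>f t\<bar> \<le> C * exp (B * t)" if "t \<ge> 0" for t
    using C(1) assms(2) that by (intro order_trans[OF C(2)]) (auto intro!: mult_right_mono)
  thus ?thesis using assms(1) C(1) unfolding exp_space_of_def by blast
qed

lemma exp_space_of_add:
  assumes "f \<in> exp_space_of A" "g \<in> exp_space_of A"
  shows "(\<lambda>t. f t + g t) \<in> exp_space_of A"
proof -
  obtain C where C: "C > 0" "\<And>t. t \<ge> 0 \<Longrightarrow> \<bar>f t\<bar> \<le> C * exp (A * t)"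
    using assms(1) by (rule exp_space_ofE) blast
  obtain D where D: "D > 0" "\<And>t. t \<ge> 0 \<Longrightarrow> \<bar>g t\<bar> \<le> D * exp (A * t)"
    using assms(2) by (rule exp_space_ofE) blast
  have "\<bar>f t + g t\<bar> \<le> (C + D) * exp (A * t)" if "t \<ge> 0" for t
    using C(2)[OF that] D(2)[OF that] by (simp add: distrib_right)
  moreover have "C + D > 0" using C D by simp
  ultimately show ?thesis
    using assms by (auto simp: exp_space_of_def locally_integrable_def)
qed

lemma exp_space_of_cmult:
  assumes "f \<in> exp_space_of A"
  shows "(\<lambda>t. a * f t) \<in> exp_space_of A"
proof -
  obtain C where C: "C > 0" "\<And>t. t \<ge> 0 \<Longrightarrow> \<bar>f t\<bar> \<le> C * exp (A * t)"
    using assms(1) by (rule exp_space_ofE) blast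
  have "\<bar>a * f t\<bar> \<le> (\<bar>a\<bar> * C + 1) * exp (A * t)" if "t \<ge> 0" for t
  proof -
    have "\<bar>a\<bar> * \<bar>f t\<bar> \<le> \<bar>a\<bar> * (C * exp (A * t))" by (intro mult_left_mono C(2) that) auto
    thus ?thesis by (simp add: abs_mult distrib_right add_increasing2)
  qed
  moreover have "\<bar>a\<bar> * C + 1 > 0" using C by (simp add: add_nonneg_pos)
  ultimately show ?thesis
    using assms by (auto simp: exp_space_of_def locally_integrable_def)
qed

lemma exp_space_of_sum:
  assumes "\<And>i. i \<in> I \<Longrightarrow> f i \<in> exp_space_of A" "finite I"
  shows "(\<lambda>t. \<Sum>i\<in>I. f i t) \<in> exp_space_of A"
  using assms(2,1)
proof (induction I)
  case empty
  have "(\<lambda>t. 0::real) \<in> exp_space_of A"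
    by (auto simp: exp_space_of_def locally_integrable_def set_integrable_def intro!: exI[of _ 1])
  thus ?case by simp
qed (simp_all add: exp_space_of_add)

lemma continuous_exp_space_of:
  assumes "continuous_on UNIV f" "C > 0" "\<And>t. t \<ge> 0 \<Longrightarrow> \<bar>f t\<bar> \<le> C * exp (A * t)"
  shows "f \<in> exp_space_of A"
proof -
  have "set_integrable lebesgue {0..b} f" for b
  proof -
    have "integrable lborel (\<lambda>x. indicator {0..b} x *\<^sub>R f x)"
      using assms(1) by (intro borel_integrable_compact) (auto intro: continuous_on_subset)
    thus ?thesis unfolding set_integrable_def by (simp add: integrable_completion)
  qed
  thus ?thesis using assms(2,3) by (auto simp: exp_space_of_def locally_integrable_def)
qed

lemma exp_in_exp_space_of: "(\<lambda>t. exp (A * t)) \<in> exp_space_of A"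
  by (rule continuous_exp_space_of[where C = 1]) (auto intro!: continuous_intros)

lemma power_le_fact_exp:
  fixes y :: real
  assumes "y \<ge> 0"
  shows "y ^ m \<le> fact m * exp y"
proof -
  have "(\<Sum>k\<in>{m}. y ^ k / fact k) \<le> exp y"
    unfolding exp_def using summable_exp[of y] assms
    by (simp add: divide_inverse scaleR_conv_of_real mult.commute)
       (rule sum_le_suminf[of _ "{m}", simplified], auto)
  thus ?thesis by (simp add: field_simps)
qed

lemma power_in_exp_space_of:
  assumes "A > 0"
  shows "(\<lambda>t. t ^ m) \<in> exp_space_of A"
proof (rule continuous_exp_space_of)
  show "fact m / A ^ m > 0" using assms by simp
  fix t :: real assume "t \<ge> 0"
  hence "(A * t) ^ m \<le> fact m * exp (A * t)" using assms by (intro power_le_fact_exp) simp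
  thus "\<bar>t ^ m\<bar> \<le> fact m / A ^ m * exp (A * t)"
    using assms \<open>t \<ge> 0\<close> by (simp add: field_simps)
qed (auto intro!: continuous_intros)

lemma shifted_power_eq:
  fixes t x :: real
  shows "(t - x) ^ s = (\<Sum>m\<le>s. real (s choose m) * (-x) ^ (s - m) * t ^ m)"
proof -
  have "(t + (-x)) ^ s = (\<Sum>m\<le>s. real (s choose m) * (-x) ^ (s - m) * t ^ m)"
    by (subst binomial_ring) (simp add: mult_ac)
  thus ?thesis by simp
qed

text \<open>
  The exponent \<open>A\<close> may be as small as desired, so the moments are available for every \<open>n > 0\<close>, not
  only for large \<open>n\<close>.
\<close>
lemma shifted_power_in_exp_space_of:
  assumes "A > 0"
  shows "(\<lambda>t. (t - x) ^ s) \<in> exp_space_of A"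
  unfolding shifted_power_eq
  by (intro exp_space_of_sum exp_space_of_cmult power_in_exp_space_of assms) auto

section \<open>Means with respect to gamma distributions\<close>

text \<open>
  Up to a constant factor the integrand is the Erlang density.
\<close>
lemma gamma_integral_power_exp:
  fixes c :: real
  assumes c: "c > 0"
  shows "set_integrable lebesgue {0..} (\<lambda>t. t ^ p * exp (- c * t))"
    and "(LINT t:{0..}|lebesgue. t ^ p * exp (- c * t)) = fact p / c ^ Suc p"
proof -
  define g where "g = (\<lambda>t::real. indicator {0..} t *\<^sub>R (t ^ p * exp (- c * t)))"
  have g_meas: "g \<in> borel_measurable lborel"
    unfolding g_def by measurable
  have g_eq: "g t = fact p / c ^ Suc p * erlang_density p c t" for t
    using c by (auto simp: g_def erlang_density_def indicator_def)
  have "(\<integral>\<^sup>+ t. ennreal (g t) \<partial>lborel)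
      = (\<integral>\<^sup>+ t. ennreal (fact p / c ^ Suc p) * ennreal (erlang_density p c t) \<partial>lborel)"
    unfolding g_eq using c by (intro nn_integral_cong ennreal_mult') simp
  also have "\<dots> = ennreal (fact p / c ^ Suc p) * (\<integral>\<^sup>+ t. ennreal (erlang_density p c t) \<partial>lborel)"
    by (intro nn_integral_cmult) auto
  also have "(\<integral>\<^sup>+ t. ennreal (erlang_density p c t) \<partial>lborel) = 1"
    using nn_integral_erlang_ith_moment[OF c, of p 0] by simp
  finally have "has_bochner_integral lborel g (fact p / c ^ Suc p)"
    using c g_meas by (intro has_bochner_integral_nn_integral AE_I2) (auto simp: g_def indicator_def)
  hence "integrable lebesgue g" "integral\<^sup>L lebesgue g = fact p / c ^ Suc p"
    using g_meas by (simp_all add: has_bochner_integral_iff integrable_completion integral_completion)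
  thus "set_integrable lebesgue {0..} (\<lambda>t. t ^ p * exp (- c * t))"
    and "(LINT t:{0..}|lebesgue. t ^ p * exp (- c * t)) = fact p / c ^ Suc p"
    by (simp_all only: set_integrable_def set_lebesgue_integral_def g_def)
qed

text \<open>
  The gamma distribution in question has shape \<open>a\<close> and rate \<open>c\<close>.
\<close>
definition gamma_mean :: "real \<Rightarrow> nat \<Rightarrow> (real \<Rightarrow> real) \<Rightarrow> real" where
  "gamma_mean c a f =
     c ^ a / Gamma (real a) * (LINT t:{0..}|lebesgue. t ^ (a - 1) * exp (- c * t) * f t)"

lemma gamma_mean_integrable:
  assumes "f \<in> exp_space_of A" "A < c"
  shows "set_integrable lebesgue {0..} (\<lambda>t. t ^ p * exp (- c * t) * f t)"
proof -
  obtain C where C: "C > 0" "\<And>t. t \<ge> 0 \<Longrightarrow> \<bar>f t\<bar> \<le> C * exp (A * t)"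
    using assms(1) by (rule exp_space_ofE) blast
  show ?thesis
  proof (rule set_integrable_bound)
    show "set_integrable lebesgue {0..} (\<lambda>t. C * (t ^ p * exp (- (c - A) * t)))"
      using gamma_integral_power_exp(1)[of "c - A" p] assms(2) by simp
    have "(\<lambda>t. t ^ p * exp (- c * t)) \<in> borel_measurable lborel" by measurable
    hence "(\<lambda>t. t ^ p * exp (- c * t)) \<in> borel_measurable lebesgue"
      by (rule measurable_completion)
    hence "(\<lambda>t. (t ^ p * exp (- c * t)) * (indicator {0..} t *\<^sub>R f t)) \<in> borel_measurable lebesgue"
      using exp_space_of_measurable[OF assms(1)] unfolding set_borel_measurable_def
      by (rule borel_measurable_times)
    thus "set_borel_measurable lebesgue {0..} (\<lambda>t. t ^ p * exp (- c * t) * f t)"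
      unfolding set_borel_measurable_def by (simp add: mult_ac)
    have "t ^ p * exp (- c * t) * \<bar>f t\<bar> \<le> \<bar>C * (t ^ p * exp (- (c - A) * t))\<bar>" if "t \<ge> 0" for t
    proof -
      have "t ^ p * exp (- c * t) * \<bar>f t\<bar> \<le> t ^ p * exp (- c * t) * (C * exp (A * t))"
        using that by (intro mult_left_mono C(2)) auto
      also have "\<dots> = C * (t ^ p * exp (- (c - A) * t))"
        by (simp add: left_diff_distrib exp_diff exp_minus field_simps)
      finally show ?thesis by linarith
    qed
    thus "AE t in lebesgue. t \<in> {0..} \<longrightarrow>
        norm (t ^ p * exp (- c * t) * f t) \<le> norm (C * (t ^ p * exp (- (c - A) * t)))"
      by (intro AE_I2) (auto simp: abs_mult)
  qed
qed

lemma gamma_mean_add: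
  assumes "f \<in> exp_space_of A" "g \<in> exp_space_of A" "A < c"
  shows "gamma_mean c a (\<lambda>t. f t + g t) = gamma_mean c a f + gamma_mean c a g"
  unfolding gamma_mean_def
  using set_integral_add(2)[OF gamma_mean_integrable[OF assms(1,3), of "a - 1"]
      gamma_mean_integrable[OF assms(2,3), of "a - 1"]]
  by (simp add: distrib_left)

lemma gamma_mean_cmult: "gamma_mean c a (\<lambda>t. b * f t) = b * gamma_mean c a f"
  unfolding gamma_mean_def by (simp add: mult.left_commute[of _ b])

lemma gamma_mean_mono:
  assumes "f \<in> exp_space_of A" "g \<in> exp_space_of A" "A < c" "c > 0" "a > 0"
    and "\<And>t. t \<ge> 0 \<Longrightarrow> f t \<le> g t"
  shows "gamma_mean c a f \<le> gamma_mean c a g"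
  unfolding gamma_mean_def
  using assms
  by (intro mult_left_mono set_integral_mono gamma_mean_integrable[OF _ assms(3)])
     (auto intro!: mult_left_mono)

lemma gamma_mean_sum:
  assumes "\<And>i. i \<in> I \<Longrightarrow> f i \<in> exp_space_of A" "finite I" "A < c"
  shows "gamma_mean c a (\<lambda>t. \<Sum>i\<in>I. f i t) = (\<Sum>i\<in>I. gamma_mean c a (f i))"
  using assms(2,1)
proof (induction I)
  case empty
  show ?case by (simp add: gamma_mean_def)
next
  case (insert i I)
  have "gamma_mean c a (\<lambda>t. f i t + (\<Sum>i\<in>I. f i t))
      = gamma_mean c a (f i) + gamma_mean c a (\<lambda>t. \<Sum>i\<in>I. f i t)"
    using insert.hyps insert.prems assms(3) by (intro gamma_mean_add exp_space_of_sum) auto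
  thus ?case using insert by simp
qed

text \<open>
  Multiplying by \<open>e\<^bsup>At\<^esup>\<close> turns the density of rate \<open>c\<close> into a multiple of the one of rate \<open>c - A\<close>.
\<close>
lemma gamma_mean_exp:
  assumes "A < c" "a > 0"
  shows "gamma_mean c a (\<lambda>t. exp (A * t)) = (c / (c - A)) ^ a"
proof -
  have eq: "t ^ (a - 1) * exp (- c * t) * exp (A * t) = t ^ (a - 1) * exp (- (c - A) * t)" for t
    by (simp add: left_diff_distrib exp_diff exp_minus field_simps)
  have "Gamma (real a) = fact (a - 1)"
    using Gamma_fact[of "a - 1", where 'a = real] assms by (simp add: of_nat_diff)
  thus ?thesis
    unfolding gamma_mean_def eq
    using gamma_integral_power_exp(2)[of "c - A" "a - 1"] assms
    by (simp add: power_divide flip: power_Suc)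
qed

lemma gamma_mean_power:
  assumes "c > 0" "a > 0"
  shows "gamma_mean c a (\<lambda>t. t ^ m) = pochhammer (real a) m / c ^ m"
proof -
  have eq: "t ^ (a - 1) * exp (- c * t) * t ^ m = t ^ (a - 1 + m) * exp (- c * t)" for t
    by (simp add: power_add)
  have "Gamma (real a) = fact (a - 1)"
    using Gamma_fact[of "a - 1", where 'a = real] assms by (simp add: of_nat_diff)
  moreover have "fact (a - 1 + m) = fact (a - 1) * pochhammer (real a) m"
    using assms pochhammer_product'[of "1::real" "a - 1" m] by (simp add: pochhammer_fact of_nat_diff)
  moreover have "c ^ Suc (a - 1 + m) = c ^ a * c ^ m"
    using assms by (simp flip: power_add)
  ultimately show ?thesis
    unfolding gamma_mean_def eq
    using gamma_integral_power_exp(2)[of c "a - 1 + m"] assms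
    by (simp del: power_Suc)
qed
text \<open>
  The geometric growth in the shape \<open>a\<close> is harmless: the Poisson weights decay faster.
\<close>
lemma gamma_mean_bound:
  assumes "f \<in> exp_space_of A" "A < c" "c > 0" "a > 0"
    and bound: "\<And>t. t \<ge> 0 \<Longrightarrow> \<bar>f t\<bar> \<le> C * exp (A * t)"
  shows "\<bar>gamma_mean c a f\<bar> \<le> C * (c / (c - A)) ^ a"
proof -
  have E: "(\<lambda>t. b * exp (A * t)) \<in> exp_space_of A" for b
    by (intro exp_space_of_cmult exp_in_exp_space_of)
  have mean_E: "gamma_mean c a (\<lambda>t. b * exp (A * t)) = b * (c / (c - A)) ^ a" for b
    using assms(2,4) by (simp only: gamma_mean_cmult gamma_mean_exp)
  have le: "f t \<le> C * exp (A * t)" "(- C) * exp (A * t) \<le> f t" if "t \<ge> 0" for t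
    using bound[OF that] by auto
  have "gamma_mean c a f \<le> gamma_mean c a (\<lambda>t. C * exp (A * t))"
    using le(1) by (intro gamma_mean_mono[OF assms(1) E assms(2,3,4)])
  moreover have "gamma_mean c a (\<lambda>t. (- C) * exp (A * t)) \<le> gamma_mean c a f"
    using le(2) by (intro gamma_mean_mono[OF E assms(1) assms(2,3,4)])
  ultimately show ?thesis unfolding mean_E by auto
qed

section \<open>Poisson weights\<close>

definition poisson_weight :: "real \<Rightarrow> nat \<Rightarrow> real" where
  "poisson_weight \<mu> \<nu> = exp (- \<mu>) * \<mu> ^ \<nu> / fact \<nu>"

text \<open>
  The terms with \<open>\<nu> < j\<close> vanish, and the series shifted by \<open>j\<close> is \<open>\<mu>\<^sup>j/j!\<close> times the total mass.
  This is why polynomials in \<open>\<nu>\<close> are expanded below in the basis \<open>\<nu> choose j\<close>.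
\<close>
lemma poisson_factorial_moment:
  "(\<lambda>\<nu>. poisson_weight \<mu> \<nu> * real (\<nu> choose j)) sums (\<mu> ^ j / fact j)"
proof -
  have "(\<lambda>\<nu>. \<mu> ^ \<nu> / fact \<nu>) sums exp \<mu>"
    using exp_converges[of \<mu>] by (simp add: field_simps)
  hence "(\<lambda>\<nu>. exp (- \<mu>) * \<mu> ^ j / fact j * (\<mu> ^ \<nu> / fact \<nu>)) sums
      (exp (- \<mu>) * \<mu> ^ j / fact j * exp \<mu>)"
    by (rule sums_mult)
  also have "(\<lambda>\<nu>. exp (- \<mu>) * \<mu> ^ j / fact j * (\<mu> ^ \<nu> / fact \<nu>))
      = (\<lambda>\<nu>. poisson_weight \<mu> (\<nu> + j) * real ((\<nu> + j) choose j))"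
    by (simp add: poisson_weight_def fun_eq_iff binomial_fact power_add)
  also have "exp (- \<mu>) * \<mu> ^ j / fact j * exp \<mu> = \<mu> ^ j / fact j"
    by (simp add: exp_minus)
  finally have "(\<lambda>\<nu>. poisson_weight \<mu> (\<nu> + j) * real ((\<nu> + j) choose j)) sums (\<mu> ^ j / fact j)" .
  moreover have "(\<Sum>\<nu><j. poisson_weight \<mu> \<nu> * real (\<nu> choose j)) = 0"
    by (intro sum.neutral) (auto simp: binomial_eq_0)
  ultimately show ?thesis
    using sums_iff_shift[of "\<lambda>\<nu>. poisson_weight \<mu> \<nu> * real (\<nu> choose j)" j] by simp
qed

lemma poisson_generating_function:
  "(\<lambda>\<nu>. poisson_weight \<mu> \<nu> * r ^ \<nu>) sums exp (\<mu> * (r - 1))"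
proof -
  have "(\<lambda>\<nu>. (\<mu> * r) ^ \<nu> / fact \<nu>) sums exp (\<mu> * r)"
    using exp_converges[of "\<mu> * r"] by (simp add: field_simps)
  hence "(\<lambda>\<nu>. exp (- \<mu>) * ((\<mu> * r) ^ \<nu> / fact \<nu>)) sums (exp (- \<mu>) * exp (\<mu> * r))"
    by (rule sums_mult)
  thus ?thesis
    by (simp add: poisson_weight_def power_mult_distrib mult_ac right_diff_distrib flip: exp_add)
qed

lemma poisson_weight_nonneg: "\<mu> \<ge> 0 \<Longrightarrow> poisson_weight \<mu> \<nu> \<ge> 0"
  by (simp add: poisson_weight_def)

section \<open>The operators as Poisson mixtures of gamma means\<close>

text \<open>
  The identity \<open>(\<beta>x)\<^sup>\<nu> (n/x)\<^bsup>n+\<nu>\<^esup> = (n\<beta>)\<^sup>\<nu> (n/x)\<^sup>n\<close> turns the terms of the defining series into Poisson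
  weights times normalised gamma integrals. The condition \<open>A x < n\<close> says that the rate \<open>n/x\<close>
  exceeds the growth exponent of \<open>f\<close>; it makes both the integrals and the series converge
  absolutely, and thereby allows pulling the constant factor into the series.
\<close>
lemma post_widder_sums:
  assumes "f \<in> exp_space_of A" "x > 0" "\<beta> \<ge> 0" "n > 0" "A * x < real n"
  shows "(\<lambda>\<nu>. poisson_weight (\<beta> * x) \<nu> * gamma_mean (real n / x) (n + \<nu>) f)
           sums post_widder \<beta> n f x"
proof -
  define c where "c = real n / x"
  have c: "c > 0" "A < c" using assms by (simp_all add: c_def field_simps)
  obtain C where C: "C > 0" "\<And>t. t \<ge> 0 \<Longrightarrow> \<bar>f t\<bar> \<le> C * exp (A * t)"
    using assms(1) by (rule exp_space_ofE) blast
  let ?g = "\<lambda>\<nu>. poisson_weight (\<beta> * x) \<nu> * gamma_mean c (n + \<nu>) f"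
  define r where "r = c / (c - A)"
  have "summable (\<lambda>\<nu>. C * r ^ n * (poisson_weight (\<beta> * x) \<nu> * r ^ \<nu>))"
    by (intro summable_mult sums_summable[OF poisson_generating_function])
  moreover have "norm (?g \<nu>) \<le> C * r ^ n * (poisson_weight (\<beta> * x) \<nu> * r ^ \<nu>)" for \<nu>
  proof -
    have "\<bar>gamma_mean c (n + \<nu>) f\<bar> \<le> C * r ^ (n + \<nu>)"
      unfolding r_def using assms c C by (intro gamma_mean_bound) auto
    hence "poisson_weight (\<beta> * x) \<nu> * \<bar>gamma_mean c (n + \<nu>) f\<bar>
        \<le> poisson_weight (\<beta> * x) \<nu> * (C * r ^ (n + \<nu>))"
      using assms by (intro mult_left_mono poisson_weight_nonneg) auto
    thus ?thesis
      using poisson_weight_nonneg[of "\<beta> * x" \<nu>] assms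
      by (simp add: abs_mult power_add mult_ac)
  qed
  ultimately have "summable ?g" by (rule summable_comparison_test'[where N = 0])
  define pre where "pre = exp (- \<beta> * x) * c ^ n"
  have pre: "pre \<noteq> 0" using c by (simp add: pre_def)
  let ?h = "\<lambda>\<nu>. (real n * \<beta>) ^ \<nu> / fact \<nu> * (1 / Gamma (real (n + \<nu>))) *
        (LINT t:{0..}|lebesgue. t ^ (n + \<nu> - 1) * exp (- real n * t / x) * f t)"
  have gh: "?g \<nu> / pre = ?h \<nu>" for \<nu>
  proof -
    have eq: "(\<beta> * x) ^ \<nu> * c ^ (n + \<nu>) = (real n * \<beta>) ^ \<nu> * c ^ n"
      using assms by (simp add: c_def power_add flip: power_mult_distrib) (simp add: mult_ac)
    define G where "G = Gamma (real (n + \<nu>))"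
    define L where "L = (LINT t:{0..}|lebesgue. t ^ (n + \<nu> - 1) * exp (- c * t) * f t)"
    have "?g \<nu> = exp (- \<beta> * x) * ((\<beta> * x) ^ \<nu> * c ^ (n + \<nu>)) / (fact \<nu> * G) * L"
      by (simp add: poisson_weight_def gamma_mean_def L_def G_def)
    also have "\<dots> = pre * ((real n * \<beta>) ^ \<nu> / fact \<nu> * (1 / G) * L)"
      unfolding eq pre_def by simp
    finally have "?g \<nu> / pre = (real n * \<beta>) ^ \<nu> / fact \<nu> * (1 / G) * L"
      using pre by simp
    thus ?thesis by (simp add: G_def L_def c_def)
  qed
  have "(\<lambda>\<nu>. ?g \<nu> / pre) sums (suminf ?g / pre)"
    using \<open>summable ?g\<close> by (intro sums_divide summable_sums)
  hence "?h sums (suminf ?g / pre)" by (simp only: gh)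
  hence "post_widder \<beta> n f x = suminf ?g"
    unfolding post_widder_def using pre by (simp add: sums_iff pre_def c_def)
  thus ?thesis using summable_sums[OF \<open>summable ?g\<close>] by (simp add: c_def)
qed

context
  fixes A \<beta> x :: real and n :: nat
  assumes x: "x > 0" and \<beta>: "\<beta> \<ge> 0" and n: "n > 0" "A * x < real n"
begin

lemma post_widder_cmult:
  assumes "f \<in> exp_space_of A"
  shows "post_widder \<beta> n (\<lambda>t. b * f t) x = b * post_widder \<beta> n f x"
proof -
  have "(\<lambda>\<nu>. b * (poisson_weight (\<beta> * x) \<nu> * gamma_mean (real n / x) (n + \<nu>) f))
      sums (b * post_widder \<beta> n f x)"
    using assms x \<beta> n by (intro sums_mult post_widder_sums)
  moreover have "(\<lambda>\<nu>. poisson_weight (\<beta> * x) \<nu> * gamma_mean (real n / x) (n + \<nu>) (\<lambda>t. b * f t))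
      sums post_widder \<beta> n (\<lambda>t. b * f t) x"
    using assms x \<beta> n by (intro post_widder_sums exp_space_of_cmult)
  ultimately show ?thesis
    by (simp add: gamma_mean_cmult mult.left_commute[of _ b] sums_unique2)
qed

lemma post_widder_sum:
  assumes "\<And>i. i \<in> I \<Longrightarrow> f i \<in> exp_space_of A" "finite I"
  shows "post_widder \<beta> n (\<lambda>t. \<Sum>i\<in>I. f i t) x = (\<Sum>i\<in>I. post_widder \<beta> n (f i) x)"
proof -
  have c: "A < real n / x" using x n by (simp add: field_simps)
  have "(\<lambda>\<nu>. \<Sum>i\<in>I. poisson_weight (\<beta> * x) \<nu> * gamma_mean (real n / x) (n + \<nu>) (f i))
      sums (\<Sum>i\<in>I. post_widder \<beta> n (f i) x)"
    using assms(1) x \<beta> n by (intro sums_sum post_widder_sums)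
  moreover have "(\<lambda>\<nu>. poisson_weight (\<beta> * x) \<nu> *
        gamma_mean (real n / x) (n + \<nu>) (\<lambda>t. \<Sum>i\<in>I. f i t))
      sums post_widder \<beta> n (\<lambda>t. \<Sum>i\<in>I. f i t) x"
    using assms x \<beta> n by (intro post_widder_sums exp_space_of_sum)
  ultimately show ?thesis
    using gamma_mean_sum[OF assms c] by (simp add: sum_distrib_left sums_unique2)
qed

lemma post_widder_add:
  assumes "f \<in> exp_space_of A" "g \<in> exp_space_of A"
  shows "post_widder \<beta> n (\<lambda>t. f t + g t) x = post_widder \<beta> n f x + post_widder \<beta> n g x"
  using post_widder_sum[of "UNIV :: bool set" "\<lambda>b. if b then f else g"] assms
  by (simp add: UNIV_bool add.commute)

lemma post_widder_mono:
  assumes "f \<in> exp_space_of A" "g \<in> exp_space_of A" and le: "\<And>t. t \<ge> 0 \<Longrightarrow> f t \<le> g t"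
  shows "post_widder \<beta> n f x \<le> post_widder \<beta> n g x"
proof (rule sums_le)
  have c: "A < real n / x" using x n by (simp add: field_simps)
  show "poisson_weight (\<beta> * x) \<nu> * gamma_mean (real n / x) (n + \<nu>) f
      \<le> poisson_weight (\<beta> * x) \<nu> * gamma_mean (real n / x) (n + \<nu>) g" for \<nu>
    using assms x \<beta> n
    by (intro mult_left_mono poisson_weight_nonneg gamma_mean_mono[OF assms(1,2) c]) auto
qed (use assms x \<beta> n in \<open>auto intro!: post_widder_sums\<close>)

lemma abs_post_widder_le:
  assumes "f \<in> exp_space_of A" "g \<in> exp_space_of A" and le: "\<And>t. t \<ge> 0 \<Longrightarrow> \<bar>f t\<bar> \<le> g t"
  shows "\<bar>post_widder \<beta> n f x\<bar> \<le> post_widder \<beta> n g x"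
proof -
  have "post_widder \<beta> n f x \<le> post_widder \<beta> n g x"
    using le by (intro post_widder_mono assms) (auto simp: abs_le_iff)
  moreover have "post_widder \<beta> n (\<lambda>t. (-1) * f t) x \<le> post_widder \<beta> n g x"
    using le by (intro post_widder_mono exp_space_of_cmult assms) (auto simp: abs_le_iff)
  ultimately show ?thesis
    using post_widder_cmult[OF assms(1), of "-1"] by simp
qed

end

text \<open>
  With \<open>y = Ax/n\<close> and \<open>r = 1/(1 - y)\<close> the mean of \<open>e\<^bsup>AT\<^esup>\<close> equals \<open>r\<^sup>n exp (\<beta>x (r - 1))\<close>. For
  \<open>y \<le> 1/2\<close> one has \<open>r \<le> 1 + 2y \<le> e\<^bsup>2y\<^esup>\<close>, which yields a bound independent of \<open>n\<close>.
\<close>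
lemma post_widder_exp_le:
  assumes "x > 0" "\<beta> \<ge> 0" "A > 0" "n > 0" "2 * A * x \<le> real n"
  shows "post_widder \<beta> n (\<lambda>t. exp (A * t)) x \<le> exp (2 * A * x + \<beta> * x)"
proof -
  define y where "y = A * x / real n"
  define r where "r = 1 / (1 - y)"
  have y: "y > 0" "y \<le> 1/2" using assms by (simp_all add: y_def field_simps)
  have r: "0 < r" "r \<le> 2" using y by (simp_all add: r_def field_simps)
  have "r \<le> 1 + 2 * y"
  proof -
    have "1 \<le> (1 + 2 * y) * (1 - y)" using y by (simp add: algebra_simps)
    thus ?thesis using y by (simp add: r_def pos_divide_le_eq)
  qed
  also have "\<dots> \<le> exp (2 * y)" by (rule exp_ge_add_one_self)
  finally have "r ^ n \<le> exp (2 * y) ^ n" using r by (intro power_mono) auto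
  also have "exp (2 * y) ^ n = exp (2 * A * x)"
    using assms by (simp add: y_def flip: exp_of_nat_mult)
  finally have r_pow: "r ^ n \<le> exp (2 * A * x)" .
  have Ax: "A * x < real n" using assms mult_pos_pos[of A x] by linarith
  hence c: "A < real n / x" using assms by (simp add: field_simps)
  have "real n / x / (real n / x - A) = r"
    using assms c y by (simp add: r_def y_def field_simps)
  hence "(\<lambda>\<nu>. poisson_weight (\<beta> * x) \<nu> * r ^ (n + \<nu>)) sums post_widder \<beta> n (\<lambda>t. exp (A * t)) x"
    using post_widder_sums[OF exp_in_exp_space_of assms(1,2,4) Ax] c assms
    by (simp add: gamma_mean_exp)
  moreover have "(\<lambda>\<nu>. r ^ n * (poisson_weight (\<beta> * x) \<nu> * r ^ \<nu>))
      sums (r ^ n * exp (\<beta> * x * (r - 1)))"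
    by (intro sums_mult poisson_generating_function)
  ultimately have "post_widder \<beta> n (\<lambda>t. exp (A * t)) x = r ^ n * exp (\<beta> * x * (r - 1))"
    by (simp add: power_add mult_ac sums_unique2)
  also have "\<dots> \<le> exp (2 * A * x) * exp (\<beta> * x)"
    using r assms by (intro mult_mono r_pow) (auto intro!: mult_left_le)
  finally show ?thesis by (simp add: exp_add)
qed

section \<open>Associated Stirling polynomials\<close>

text \<open>
  The series \<open>F = e\<^bsup>-tu\<^esup> (1 - t)\<^bsup>-u\<^esup>\<close> satisfies \<open>(1 - t) F' = u t F\<close>; the recurrence compares the
  coefficients of \<open>t\<^bsup>i+1\<^esup>\<close>.
\<close>
lemma fps_nth_stirling2_gf_recurrence:
  "fps_nth stirling2_gf 0 = 1" "fps_nth stirling2_gf 1 = 0"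
  "smult (real (i + 2)) (fps_nth stirling2_gf (i + 2)) =
     smult (real (i + 1)) (fps_nth stirling2_gf (i + 1)) + [:0, 1:] * fps_nth stirling2_gf i"
proof -
  define U :: "real poly" where "U = [:0, 1:]"
  define E where "E = Abs_fps (\<lambda>i. smult (1 / fact i) ((- U) ^ i))"
  define B where "B = Abs_fps (\<lambda>i. smult (1 / fact i) (pochhammer U i))"
  define F where "F = E * B"
  have F: "F = stirling2_gf" by (simp add: F_def E_def B_def U_def stirling2_gf_def)
  have nat_smult: "of_nat k * p = smult (real k) p" for k and p :: "real poly"
    by (simp add: of_nat_poly)
  have dE: "fps_deriv E = - (fps_const U * E)"
  proof (rule fps_ext)
    fix n
    show "fps_nth (fps_deriv E) n = fps_nth (- (fps_const U * E)) n"
      by (simp add: E_def nat_smult field_simps del: of_nat_Suc)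
  qed
  have dB: "(1 - fps_X) * fps_deriv B = fps_const U * B"
  proof (rule fps_ext)
    fix n
    have rec: "of_nat (Suc m) * fps_nth B (Suc m) = (U + of_nat m) * fps_nth B m" for m
    proof -
      have "of_nat (Suc m) * fps_nth B (Suc m) =
          smult (real (Suc m) * (1 / fact (Suc m))) (pochhammer U m * (U + of_nat m))"
        by (simp only: nat_smult B_def fps_nth_Abs_fps smult_smult pochhammer_Suc)
      also have "real (Suc m) * (1 / fact (Suc m)) = 1 / fact m"
        by (simp del: of_nat_Suc)
      finally show ?thesis by (simp add: B_def mult.commute)
    qed
    show "fps_nth ((1 - fps_X) * fps_deriv B) n = fps_nth (fps_const U * B) n"
    proof (cases n)
      case 0
      thus ?thesis using rec[of 0] by (simp add: left_diff_distrib)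
    next
      case (Suc m)
      have "fps_nth ((1 - fps_X) * fps_deriv B) n
          = of_nat (Suc n) * fps_nth B (Suc n) - of_nat n * fps_nth B n"
        by (simp add: left_diff_distrib Suc del: of_nat_Suc)
      also have "\<dots> = U * fps_nth B n"
        unfolding rec by (simp add: algebra_simps)
      finally show ?thesis by simp
    qed
  qed
  have "(1 - fps_X) * fps_deriv F = (1 - fps_X) * (fps_deriv E * B) + E * ((1 - fps_X) * fps_deriv B)"
    by (simp add: F_def algebra_simps)
  also have "\<dots> = fps_const U * fps_X * F"
    unfolding dE dB by (simp add: F_def algebra_simps)
  finally have ode: "(1 - fps_X) * fps_deriv F = fps_const U * fps_X * F" .
  show "fps_nth stirling2_gf 0 = 1"
    by (simp add: fps_nth_stirling2_gf)
  show "fps_nth stirling2_gf 1 = 0"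
    by (simp add: fps_nth_stirling2_gf)
  have "fps_nth ((1 - fps_X) * fps_deriv F) (i + 1) = fps_nth (fps_const U * fps_X * F) (i + 1)"
    by (simp only: ode)
  hence "of_nat (i + 2) * fps_nth F (i + 2) - of_nat (i + 1) * fps_nth F (i + 1) = U * fps_nth F i"
    by (simp add: left_diff_distrib mult.assoc del: of_nat_Suc of_nat_add)
  thus "smult (real (i + 2)) (fps_nth stirling2_gf (i + 2)) =
     smult (real (i + 1)) (fps_nth stirling2_gf (i + 1)) + [:0, 1:] * fps_nth stirling2_gf i"
    by (simp only: F nat_smult U_def)
qed

text \<open>
  In the recurrence the factor \<open>u\<close> appears only together with a step of length two in the index.
\<close>
lemma degree_stirling2_gf: "2 * degree (fps_nth stirling2_gf i) \<le> i"
proof (induction i rule: less_induct)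
  case (less i)
  consider "i = 0" | "i = 1" | k where "i = k + 2"
    by (metis One_nat_def Suc_1 add.commute add_2_eq_Suc' not0_implies_Suc)
  thus ?case
  proof cases
    case 3
    let ?F = "fps_nth stirling2_gf"
    have "degree (?F i) = degree (smult (real (k + 2)) (?F (k + 2)))" using 3 by simp
    also have "\<dots> \<le> max (degree (smult (real (k + 1)) (?F (k + 1)))) (degree ([:0, 1:] * ?F k))"
      unfolding fps_nth_stirling2_gf_recurrence(3) by (rule degree_add_le_max)
    also have "\<dots> \<le> max (degree (?F (k + 1))) (1 + degree (?F k))"
      using degree_mult_le[of "[:0, 1:]" "?F k"] by (intro max.mono) auto
    finally show ?thesis using less[of "k + 1"] less[of k] 3 by auto
  qed (use fps_nth_stirling2_gf_recurrence in auto)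
qed

lemma s2_eq_0: "i < 2 * j \<Longrightarrow> s2 i j = 0"
  using degree_stirling2_gf[of i] unfolding s2_def by (simp add: coeff_eq_0)

lemma poly_stirling2_gf:
  assumes "i \<le> d"
  shows "poly (fps_nth stirling2_gf i) y = (\<Sum>m\<le>d. s2 i m / fact i * y ^ m)"
proof -
  have "degree (fps_nth stirling2_gf i) \<le> d" using degree_stirling2_gf[of i] assms by linarith
  hence "poly (fps_nth stirling2_gf i) y = (\<Sum>m\<le>d. coeff (fps_nth stirling2_gf i) m * y ^ m)"
    unfolding poly_altdef by (intro sum.mono_neutral_left) (auto simp: coeff_eq_0)
  thus ?thesis by (simp add: s2_def)
qed

section \<open>Central moments\<close>

text \<open>
  Vandermonde's identity for \<open>(\<nu> + (i - 1)) gchoose i\<close>. This is where the binomial coefficients of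
  \<open>a_coeff\<close> come from, including the value \<open>(-1) gchoose 0 = 1\<close> at \<open>i = 0\<close>.
\<close>
lemma pochhammer_conv_binomials:
  "pochhammer (real \<nu>) i / fact i =
     (\<Sum>j\<le>i. ((real i - 1) gchoose (i - j)) * real (\<nu> choose j))"
proof -
  have "pochhammer (real \<nu>) i / fact i = (real \<nu> + (real i - 1)) gchoose i"
    by (simp add: gbinomial_pochhammer' algebra_simps)
  also have "\<dots> = (\<Sum>j\<le>i. (real \<nu> gchoose j) * ((real i - 1) gchoose (i - j)))"
    by (simp flip: gbinomial_Vandermonde add: atLeast0AtMost)
  finally show ?thesis by (simp add: binomial_gbinomial mult.commute)
qed

text \<open>
  The rising factorials are the moments of a standard gamma variable \<open>S\<close> of shape \<open>y + z\<close>, so the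
  left-hand side is the moment of order \<open>s\<close> of \<open>S - y\<close>. It is \<open>s!\<close> times the coefficient of \<open>t\<^sup>s\<close> in
  \<open>e\<^bsup>-ty\<^esup> (1 - t)\<^bsup>-y-z\<^esup>\<close>, and splitting off \<open>(1 - t)\<^bsup>-z\<^esup>\<close> leaves the Stirling generating function
  at \<open>u = y\<close>.
\<close>
lemma centred_pochhammer_expansion:
  fixes y z :: real
  shows "(\<Sum>m\<le>s. real (s choose m) * (- y) ^ (s - m) * pochhammer (y + z) m) =
    fact s * (\<Sum>i\<le>s. poly (fps_nth stirling2_gf (s - i)) y * (pochhammer z i / fact i))"
proof -
  define E where "E = Abs_fps (\<lambda>i. (- y) ^ i / fact i)"
  define B where "B w = Abs_fps (\<lambda>i. pochhammer w i / fact i)" for w :: real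
  have B_add: "B (y + z) = B y * B z"
  proof (rule fps_ext)
    fix n
    show "fps_nth (B (y + z)) n = fps_nth (B y * B z) n"
      by (simp add: B_def fps_mult_nth atLeast0AtMost pochhammer_binomial_sum sum_divide_distrib
          binomial_fact)
  qed
  have EB: "fps_nth (E * B y) n = poly (fps_nth stirling2_gf n) y" for n
    by (simp add: fps_nth_stirling2_gf E_def B_def fps_mult_nth atLeast0AtMost poly_sum
        poly_pochhammer) (simp add: mult_ac)
  have "(\<Sum>m\<le>s. real (s choose m) * (- y) ^ (s - m) * pochhammer (y + z) m)
      = fact s * fps_nth (B (y + z) * E) s"
    unfolding fps_mult_nth sum_distrib_left atLeast0AtMost
    by (intro sum.cong) (auto simp: E_def B_def binomial_fact)
  also have "B (y + z) * E = B z * (E * B y)"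
    unfolding B_add by (simp add: mult_ac)
  also have "fps_nth (B z * (E * B y)) s =
      (\<Sum>i\<le>s. poly (fps_nth stirling2_gf (s - i)) y * (pochhammer z i / fact i))"
    unfolding fps_mult_nth[of "B z"] EB atLeast0AtMost by (simp add: B_def mult.commute)
  finally show ?thesis .
qed

text \<open>
  This turns out to be the coefficient of \<open>x\<^sup>s n\<^bsup>-k\<^esup>\<close> in the central moment of order \<open>s\<close>, where
  \<open>\<mu> = \<beta>x\<close>.
\<close>
definition moment_coeff :: "real \<Rightarrow> nat \<Rightarrow> nat \<Rightarrow> real" where
  "moment_coeff \<mu> k s = (\<Sum>j = 0..k. a_coeff k s j * (\<mu> ^ j / fact j))"

lemma a_coeff_eq_0: "2 * k < s \<Longrightarrow> a_coeff k s j = 0"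
  unfolding a_coeff_def by (intro sum.neutral) (auto simp: s2_eq_0)

lemma moment_coeff_eq_0: "2 * k < s \<Longrightarrow> moment_coeff \<mu> k s = 0"
  by (simp add: moment_coeff_def a_coeff_eq_0)

text \<open>
  The upper limit \<open>min k (2k - s)\<close> in \<open>a_coeff\<close> only cuts off terms that vanish because
  \<open>2(s - k) > s - i\<close>. Removing it gives the form in which the coefficient appears in the product of
  the two generating functions.
\<close>
lemma moment_coeff_altdef:
  assumes "k \<le> s"
  shows "moment_coeff \<mu> k s =
    (\<Sum>i\<le>s. \<Sum>j\<le>i. fact s * (s2 (s - i) (s - k) / fact (s - i)) *
        (((real i - 1) gchoose (i - j)) * (\<mu> ^ j / fact j)))"
    (is "_ = (\<Sum>i\<le>s. \<Sum>j\<le>i. ?h i j)")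
proof -
  define M where "M = min k (2 * k - s)"
  have vanish: "?h i j = 0" if "M < i" "i \<le> s" for i j
  proof -
    have "s - i < 2 * (s - k)" using that assms unfolding M_def by auto
    thus ?thesis by (simp add: s2_eq_0)
  qed
  have "moment_coeff \<mu> k s = (\<Sum>j\<le>k. \<Sum>i\<in>{j..M}. ?h i j)"
    unfolding moment_coeff_def a_coeff_def M_def atLeast0AtMost sum_distrib_right
    by (intro sum.cong) (auto simp: mult_ac)
  also have "\<dots> = (\<Sum>j\<le>k. \<Sum>i\<in>{i\<in>{..M}. j \<le> i}. ?h i j)"
    by (intro sum.cong) auto
  also have "\<dots> = (\<Sum>i\<le>M. \<Sum>j\<in>{j\<in>{..k}. j \<le> i}. ?h i j)"
    by (rule sum.swap_restrict) auto
  also have "\<dots> = (\<Sum>i\<le>M. \<Sum>j\<le>i. ?h i j)"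
    by (intro sum.cong) (auto simp: M_def)
  also have "\<dots> = (\<Sum>i\<le>s. \<Sum>j\<le>i. ?h i j)"
  proof (rule sum.mono_neutral_left)
    show "{..M} \<subseteq> {..s}" using assms by (auto simp: M_def)
    show "\<forall>i\<in>{..s} - {..M}. (\<Sum>j\<le>i. ?h i j) = 0"
    proof
      fix i assume "i \<in> {..s} - {..M}"
      thus "(\<Sum>j\<le>i. ?h i j) = 0" by (intro sum.neutral ballI vanish) auto
    qed
  qed simp
  finally show ?thesis .
qed

lemma moment_coeff_0_0: "moment_coeff \<mu> 0 0 = 1"
  by (simp add: moment_coeff_def a_coeff_def s2_def fps_nth_stirling2_gf_recurrence(1))
text \<open>
  The rescaled variable \<open>nT/x\<close> is standard gamma of shape \<open>n + \<nu>\<close>, to be centred at \<open>n\<close>.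
\<close>
lemma gamma_mean_centred_power:
  assumes "x > 0" "n > 0"
  shows "gamma_mean (real n / x) (n + \<nu>) (\<lambda>t. (t - x) ^ s) =
    (x / real n) ^ s * fact s * (\<Sum>i\<le>s. poly (fps_nth stirling2_gf (s - i)) (real n) *
        (\<Sum>j\<le>i. ((real i - 1) gchoose (i - j)) * real (\<nu> choose j)))"
proof -
  define c where "c = real n / x"
  have c: "c > 0" using assms by (simp add: c_def)
  have "gamma_mean c (n + \<nu>) (\<lambda>t. (t - x) ^ s) =
      (\<Sum>m\<le>s. real (s choose m) * (-x) ^ (s - m) * (pochhammer (real (n + \<nu>)) m / c ^ m))"
    unfolding shifted_power_eq using c assms
    by (subst gamma_mean_sum[where A = "c / 2"])
       (auto simp: gamma_mean_cmult gamma_mean_power intro!: exp_space_of_cmult power_in_exp_space_of)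
  also have "\<dots> = (x / real n) ^ s *
      (\<Sum>m\<le>s. real (s choose m) * (- real n) ^ (s - m) * pochhammer (real n + real \<nu>) m)"
    unfolding sum_distrib_left
  proof (rule sum.cong)
    fix m assume "m \<in> {..s}"
    hence "(x / real n) ^ s = (x / real n) ^ (s - m) * (1 / c ^ m)"
      by (simp add: c_def power_divide flip: power_add)
    moreover have "(x / real n) ^ (s - m) * (- real n) ^ (s - m) = (- x) ^ (s - m)"
      using assms by (simp flip: power_mult_distrib)
    ultimately show "real (s choose m) * (-x) ^ (s - m) * (pochhammer (real (n + \<nu>)) m / c ^ m) =
      (x / real n) ^ s * (real (s choose m) * (- real n) ^ (s - m) * pochhammer (real n + real \<nu>) m)"
      by (simp add: mult_ac)
  qed simp
  finally show ?thesis
    unfolding c_def centred_pochhammer_expansion pochhammer_conv_binomials by (simp only: mult.assoc)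
qed

lemma post_widder_central_moment:
  assumes "x > 0" "\<beta> \<ge> 0" "n > 0"
  shows "post_widder \<beta> n (\<lambda>t. (t - x) ^ s) x =
    x ^ s * (\<Sum>k\<le>s. moment_coeff (\<beta> * x) k s / real n ^ k)"
proof -
  define \<mu> where "\<mu> = \<beta> * x"
  define P where "P i = poly (fps_nth stirling2_gf (s - i)) (real n)" for i
  define G where "G i j = ((real i - 1) gchoose (i - j))" for i j :: nat
  (* any growth exponent below the rate n/x will do *)
  define A where "A = real n / (2 * x)"
  have A: "A > 0" "A * x < real n" using assms by (simp_all add: A_def)
  have "(\<lambda>\<nu>. (x / real n) ^ s * fact s *
        (\<Sum>i\<le>s. P i * (\<Sum>j\<le>i. G i j * (poisson_weight \<mu> \<nu> * real (\<nu> choose j)))))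
      sums ((x / real n) ^ s * fact s * (\<Sum>i\<le>s. P i * (\<Sum>j\<le>i. G i j * (\<mu> ^ j / fact j))))"
    by (intro sums_mult sums_sum poisson_factorial_moment)
  moreover have "(\<lambda>\<nu>. (x / real n) ^ s * fact s *
        (\<Sum>i\<le>s. P i * (\<Sum>j\<le>i. G i j * (poisson_weight \<mu> \<nu> * real (\<nu> choose j)))))
      sums post_widder \<beta> n (\<lambda>t. (t - x) ^ s) x"
    using post_widder_sums[OF shifted_power_in_exp_space_of[OF A(1)] assms A(2), of x s]
    unfolding gamma_mean_centred_power[OF assms(1,3)]
    by (simp add: P_def G_def \<mu>_def sum_distrib_left mult_ac)
  ultimately have "post_widder \<beta> n (\<lambda>t. (t - x) ^ s) x
      = (x / real n) ^ s * fact s * (\<Sum>i\<le>s. P i * (\<Sum>j\<le>i. G i j * (\<mu> ^ j / fact j)))"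
    by (rule sums_unique2[symmetric])
  also have "\<dots> = x ^ s * (\<Sum>i\<le>s. P i / real n ^ s * (fact s * (\<Sum>j\<le>i. G i j * (\<mu> ^ j / fact j))))"
    by (simp add: power_divide sum_distrib_left mult_ac)
  also have "(\<Sum>i\<le>s. P i / real n ^ s * (fact s * (\<Sum>j\<le>i. G i j * (\<mu> ^ j / fact j)))) =
      (\<Sum>i\<le>s. \<Sum>k\<le>s. (\<Sum>j\<le>i. fact s * (s2 (s - i) (s - k) / fact (s - i)) *
          (G i j * (\<mu> ^ j / fact j))) / real n ^ k)"
  proof (rule sum.cong)
    fix i assume "i \<in> {..s}"
    have "P i = (\<Sum>m\<le>s. s2 (s - i) m / fact (s - i) * real n ^ m)"
      unfolding P_def by (rule poly_stirling2_gf) simp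
    also have "\<dots> = (\<Sum>k\<le>s. s2 (s - i) (s - k) / fact (s - i) * real n ^ (s - k))"
      by (rule sum.reindex_bij_witness[of _ "\<lambda>k. s - k" "\<lambda>k. s - k"]) auto
    finally have "P i / real n ^ s = (\<Sum>k\<le>s. s2 (s - i) (s - k) / fact (s - i) / real n ^ k)"
      using assms(3) by (simp add: sum_divide_distrib power_diff)
    show "P i / real n ^ s * (fact s * (\<Sum>j\<le>i. G i j * (\<mu> ^ j / fact j))) =
      (\<Sum>k\<le>s. (\<Sum>j\<le>i. fact s * (s2 (s - i) (s - k) / fact (s - i)) *
          (G i j * (\<mu> ^ j / fact j))) / real n ^ k)"
      unfolding \<open>P i / real n ^ s = _\<close> sum_distrib_right
      by (intro sum.cong refl) (subst sum_distrib_left[symmetric], simp)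
  qed simp
  also have "\<dots> = (\<Sum>k\<le>s. moment_coeff \<mu> k s / real n ^ k)"
    by (subst sum.swap)
       (simp add: moment_coeff_altdef G_def sum_divide_distrib)
  finally show ?thesis by (simp add: \<mu>_def)
qed

lemma sum_inverse_powers_le:
  fixes d :: "nat \<Rightarrow> real"
  assumes "n > 0" "\<And>k. k \<in> K \<Longrightarrow> m \<le> k"
  shows "\<bar>\<Sum>k\<in>K. d k / real n ^ k\<bar> \<le> (\<Sum>k\<in>K. \<bar>d k\<bar>) / real n ^ m"
proof -
  have "\<bar>\<Sum>k\<in>K. d k / real n ^ k\<bar> \<le> (\<Sum>k\<in>K. \<bar>d k / real n ^ k\<bar>)" by (rule sum_abs)
  also have "\<dots> \<le> (\<Sum>k\<in>K. \<bar>d k\<bar> / real n ^ m)"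
  proof (rule sum_mono)
    fix k assume "k \<in> K"
    hence "real n ^ m \<le> real n ^ k" using assms by (intro power_increasing) auto
    thus "\<bar>d k / real n ^ k\<bar> \<le> \<bar>d k\<bar> / real n ^ m"
      using assms(1) by (simp add: abs_divide) (intro divide_left_mono, auto)
  qed
  finally show ?thesis by (simp add: sum_divide_distrib)
qed

text \<open>
  The coefficients of \<open>n\<^bsup>-k\<^esup>\<close> with \<open>2k < 2m\<close> vanish, so the moment is a polynomial in \<open>1/n\<close> that
  starts with the power \<open>m\<close>.
\<close>
lemma post_widder_even_moment_le:
  assumes "x > 0" "\<beta> \<ge> 0"
  obtains M where "M \<ge> 0"
    "\<And>n. n > 0 \<Longrightarrow> post_widder \<beta> n (\<lambda>t. (t - x) ^ (2 * m)) x \<le> M / real n ^ m"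
proof
  let ?S = "\<Sum>k=m..2*m. \<bar>moment_coeff (\<beta> * x) k (2 * m)\<bar>"
  show "x ^ (2 * m) * ?S \<ge> 0" using assms by (intro mult_nonneg_nonneg sum_nonneg) auto
  fix n :: nat assume n: "n > 0"
  have "post_widder \<beta> n (\<lambda>t. (t - x) ^ (2 * m)) x =
      x ^ (2 * m) * (\<Sum>k=m..2*m. moment_coeff (\<beta> * x) k (2 * m) / real n ^ k)"
    unfolding post_widder_central_moment[OF assms n]
    by (intro arg_cong2[where f = "(*)"] sum.mono_neutral_right refl)
       (auto simp: moment_coeff_eq_0)
  also have "\<dots> \<le> x ^ (2 * m) * (?S / real n ^ m)"
  proof (rule mult_left_mono)
    have "\<bar>\<Sum>k=m..2*m. moment_coeff (\<beta> * x) k (2 * m) / real n ^ k\<bar> \<le> ?S / real n ^ m"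
      using n by (intro sum_inverse_powers_le) auto
    thus "(\<Sum>k=m..2*m. moment_coeff (\<beta> * x) k (2 * m) / real n ^ k) \<le> ?S / real n ^ m"
      by linarith
  qed (use assms in simp)
  finally show "post_widder \<beta> n (\<lambda>t. (t - x) ^ (2 * m)) x \<le> x ^ (2 * m) * ?S / real n ^ m"
    by simp
qed

section \<open>Taylor's theorem with Peano remainder\<close>

lemma has_nth_derivative_at_imp_differentiable:
  "has_nth_derivative_at (Suc n) f x \<Longrightarrow> f differentiable (at x)"
  by (induction n) (auto dest: eventually_nhds_x_imp_x)

lemma has_nth_derivative_at_deriv:
  "has_nth_derivative_at (Suc n) f x \<Longrightarrow> has_nth_derivative_at n (deriv f) x"
proof (induction n arbitrary: x)
  case (Suc n)
  have "\<forall>\<^sub>F y in nhds x. has_nth_derivative_at (Suc n) f y"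
    using Suc.prems has_nth_derivative_at.simps(2)[of "Suc n" f x] by blast
  hence "\<forall>\<^sub>F y in nhds x. has_nth_derivative_at n (deriv f) y"
    by eventually_elim (rule Suc.IH)
  moreover have "(deriv ^^ n) (deriv f) differentiable (at x)"
    using Suc.prems by (simp add: funpow_swap1)
  ultimately show ?case by (simp only: has_nth_derivative_at.simps)
qed simp

text \<open>
  As a function of the evaluation point \<open>t\<close>, so that partial application is the polynomial itself.
\<close>
definition taylor_poly :: "nat \<Rightarrow> (real \<Rightarrow> real) \<Rightarrow> real \<Rightarrow> real \<Rightarrow> real" where
  "taylor_poly m f x t = (\<Sum>s\<le>m. (deriv ^^ s) f x / fact s * (t - x) ^ s)"

lemma taylor_poly_has_derivative:
  "(taylor_poly (Suc m) f x has_real_derivative taylor_poly m (deriv f) x t) (at t)"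
proof -
  have "((\<lambda>t. \<Sum>s\<le>m. (deriv ^^ s) (deriv f) x / fact (Suc s) * (t - x) ^ Suc s)
      has_real_derivative (\<Sum>s\<le>m. (deriv ^^ s) (deriv f) x / fact s * (t - x) ^ s)) (at t)"
  proof (rule DERIV_sum)
    fix s
    have "((\<lambda>t. (t - x) ^ Suc s) has_real_derivative real (Suc s) * (t - x) ^ s) (at t)"
      by (rule derivative_eq_intros refl)+ simp
    from DERIV_cmult[OF this, of "(deriv ^^ s) (deriv f) x / fact (Suc s)"]
    show "((\<lambda>t. (deriv ^^ s) (deriv f) x / fact (Suc s) * (t - x) ^ Suc s)
        has_real_derivative (deriv ^^ s) (deriv f) x / fact s * (t - x) ^ s) (at t)"
      by (simp del: power_Suc of_nat_Suc)
  qed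
  from DERIV_add[OF DERIV_const this, of "f x"]
  have "((\<lambda>t. f x + (\<Sum>s\<le>m. (deriv ^^ s) (deriv f) x / fact (Suc s) * (t - x) ^ Suc s))
      has_real_derivative taylor_poly m (deriv f) x t) (at t)"
    by (simp only: taylor_poly_def add_0)
  moreover have "taylor_poly (Suc m) f x =
      (\<lambda>t. f x + (\<Sum>s\<le>m. (deriv ^^ s) (deriv f) x / fact (Suc s) * (t - x) ^ Suc s))"
    by (simp add: taylor_poly_def fun_eq_iff sum.atMost_Suc_shift funpow_swap1 del: fact_Suc sum.atMost_Suc)
  ultimately show ?thesis by simp
qed

text \<open>
  Induction on the order: the derivative of the remainder of \<open>f\<close> is the remainder of \<open>deriv f\<close>, which
  is small by the induction hypothesis, and the mean value inequality gains one power of \<open>\<bar>t - x\<bar>\<close>.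
  Only the base case uses a derivative at the single point \<open>x\<close>.
\<close>
lemma taylor_peano:
  assumes "has_nth_derivative_at (Suc m) f x" and "\<epsilon> > 0"
  shows "\<exists>\<delta>>0. \<forall>t. \<bar>t - x\<bar> < \<delta> \<longrightarrow> \<bar>f t - taylor_poly (Suc m) f x t\<bar> \<le> \<epsilon> * \<bar>t - x\<bar> ^ Suc m"
  using assms
proof (induction m arbitrary: f)
  case 0
  have "f differentiable (at x)"
    using 0(1) by (rule has_nth_derivative_at_imp_differentiable)
  hence "(f has_derivative (\<lambda>h. h * deriv f x)) (at x)"
    using DERIV_deriv_iff_real_differentiable[of f x]
    by (simp add: has_field_derivative_def mult_commute_abs)
  from this[unfolded has_derivative_at_alt] obtain \<delta> where "\<delta> > 0"
    "\<forall>y. norm (y - x) < \<delta> \<longrightarrow> norm (f y - f x - (y - x) * deriv f x) \<le> \<epsilon> * norm (y - x)"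
    using 0(2) by blast
  thus ?case by (intro exI[of _ \<delta>]) (auto simp: taylor_poly_def algebra_simps)
next
  case (Suc m)
  let ?R = "\<lambda>t. f t - taylor_poly (Suc (Suc m)) f x t"
  have "has_nth_derivative_at (Suc m) (deriv f) x"
    using Suc.prems(1) by (rule has_nth_derivative_at_deriv)
  then obtain \<delta>1 where \<delta>1: "\<delta>1 > 0"
    "\<And>t. \<bar>t - x\<bar> < \<delta>1 \<Longrightarrow> \<bar>deriv f t - taylor_poly (Suc m) (deriv f) x t\<bar> \<le> \<epsilon> * \<bar>t - x\<bar> ^ Suc m"
    using Suc.IH Suc.prems(2) by blast
  have "\<forall>\<^sub>F y in nhds x. has_nth_derivative_at (Suc m) f y"
    using Suc.prems(1) has_nth_derivative_at.simps(2)[of "Suc m" f x] by blast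
  then obtain \<delta>2 where \<delta>2: "\<delta>2 > 0" "\<And>y. \<bar>y - x\<bar> < \<delta>2 \<Longrightarrow> has_nth_derivative_at (Suc m) f y"
    unfolding eventually_nhds_metric dist_real_def by blast
  have deriv: "(?R has_real_derivative (deriv f t - taylor_poly (Suc m) (deriv f) x t)) (at t)"
    if "\<bar>t - x\<bar> < \<delta>2" for t
    using has_nth_derivative_at_imp_differentiable[OF \<delta>2(2)[OF that]]
    by (intro DERIV_diff taylor_poly_has_derivative)
       (simp add: DERIV_deriv_iff_real_differentiable)
  have "\<bar>?R t\<bar> \<le> \<epsilon> * \<bar>t - x\<bar> ^ Suc (Suc m)" if t: "\<bar>t - x\<bar> < min \<delta>1 \<delta>2" for t
  proof -
    have "norm (?R t - ?R x) \<le> (\<epsilon> * \<bar>t - x\<bar> ^ Suc m) * norm (t - x)"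
    proof (rule field_differentiable_bound[where S = "closed_segment x t"])
      fix z assume "z \<in> closed_segment x t"
      hence z: "\<bar>z - x\<bar> \<le> \<bar>t - x\<bar>"
        using segment_bound1[of z x t] by (simp add: real_norm_def)
      show "(?R has_real_derivative (deriv f z - taylor_poly (Suc m) (deriv f) x z))
          (at z within closed_segment x t)"
        by (rule has_field_derivative_at_within[OF deriv]) (use z t in linarith)
      have "\<bar>deriv f z - taylor_poly (Suc m) (deriv f) x z\<bar> \<le> \<epsilon> * \<bar>z - x\<bar> ^ Suc m"
        by (rule \<delta>1(2)) (use z t in linarith)
      also have "\<dots> \<le> \<epsilon> * \<bar>t - x\<bar> ^ Suc m"
        using z Suc.prems(2) by (intro mult_left_mono power_mono) auto
      finally show "norm (deriv f z - taylor_poly (Suc m) (deriv f) x z) \<le> \<epsilon> * \<bar>t - x\<bar> ^ Suc m"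
        by simp
    qed auto
    moreover have "?R x = 0"
      by (simp add: taylor_poly_def sum.atMost_Suc_shift del: sum.atMost_Suc)
    ultimately show ?thesis by (simp add: mult_ac)
  qed
  thus ?case using \<delta>1(1) \<delta>2(1) by (intro exI[of _ "min \<delta>1 \<delta>2"]) auto
qed

section \<open>The asymptotic expansion\<close>

lemma c_coeff_eq: "c_coeff \<beta> k f x =
    (\<Sum>s=k..2*k. (deriv ^^ s) f x / fact s * x ^ s * moment_coeff (\<beta> * x) k s)"
  by (simp add: c_coeff_def moment_coeff_def)

lemma c_coeff_0: "c_coeff \<beta> 0 f x = f x"
  by (simp add: c_coeff_eq moment_coeff_0_0)

lemma taylor_poly_in_exp_space_of:
  "A > 0 \<Longrightarrow> taylor_poly m f x \<in> exp_space_of A"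
  unfolding taylor_poly_def
  by (intro exp_space_of_sum exp_space_of_cmult shifted_power_in_exp_space_of) auto

text \<open>
  For \<open>k \<le> q\<close> the central moments of order \<open>s \<in> {k..2k}\<close> are the only ones that contribute to
  \<open>n\<^bsup>-k\<^esup>\<close>, and all of them belong to the Taylor polynomial of degree \<open>2q\<close>. What remains are the powers
  \<open>n\<^bsup>-k\<^esup>\<close> with \<open>q < k \<le> 2q\<close>.
\<close>
lemma post_widder_taylor_poly:
  assumes "x > 0" "\<beta> \<ge> 0"
  obtains D where "\<And>n. n > 0 \<Longrightarrow>
    \<bar>post_widder \<beta> n (taylor_poly (2 * q) f x) x
       - (f x + (\<Sum>k=1..q. 1 / real n ^ k * c_coeff \<beta> k f x))\<bar> \<le> D / real n ^ Suc q"
proof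
  define d where
    "d k = (\<Sum>s\<in>{s\<in>{..2*q}. k \<le> s}. (deriv ^^ s) f x / fact s * x ^ s * moment_coeff (\<beta> * x) k s)"
    for k
  have d_eq: "d k = c_coeff \<beta> k f x" if "k \<le> q" for k
    unfolding d_def c_coeff_eq using that
    by (intro sum.mono_neutral_right) (auto simp: moment_coeff_eq_0)
  fix n :: nat assume n: "n > 0"
  define A where "A = real n / (2 * x)"
  have A: "A > 0" "A * x < real n" using assms n by (simp_all add: A_def)
  have "post_widder \<beta> n (taylor_poly (2 * q) f x) x =
      (\<Sum>s\<le>2*q. (deriv ^^ s) f x / fact s * post_widder \<beta> n (\<lambda>t. (t - x) ^ s) x)"
    unfolding taylor_poly_def
    by (subst post_widder_sum[OF assms n A(2)])
       (auto intro!: sum.cong exp_space_of_cmult shifted_power_in_exp_space_of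
          post_widder_cmult[OF assms n A(2)] A(1) simp del: times_divide_eq_left)
  also have "\<dots> = (\<Sum>s\<le>2*q. \<Sum>k\<in>{k\<in>{..2*q}. k \<le> s}.
      (deriv ^^ s) f x / fact s * x ^ s * moment_coeff (\<beta> * x) k s / real n ^ k)"
    unfolding post_widder_central_moment[OF assms n] sum_distrib_left
    by (intro sum.cong) auto
  also have "\<dots> = (\<Sum>k\<le>2*q. d k / real n ^ k)"
    unfolding d_def sum_divide_distrib by (rule sum.swap_restrict) auto
  also have "{..2*q} = insert 0 {1..q} \<union> {Suc q..2*q}" by auto
  also have "(\<Sum>k\<in>insert 0 {1..q} \<union> {Suc q..2*q}. d k / real n ^ k) =
      (f x + (\<Sum>k=1..q. 1 / real n ^ k * c_coeff \<beta> k f x)) + (\<Sum>k=Suc q..2*q. d k / real n ^ k)"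
    by (subst sum.union_disjoint) (auto simp: d_eq c_coeff_0)
  finally show "\<bar>post_widder \<beta> n (taylor_poly (2 * q) f x) x
       - (f x + (\<Sum>k=1..q. 1 / real n ^ k * c_coeff \<beta> k f x))\<bar> \<le> (\<Sum>k=Suc q..2*q. \<bar>d k\<bar>) / real n ^ Suc q"
    using sum_inverse_powers_le[OF n, of "{Suc q..2*q}" "Suc q" d] by auto
qed

text \<open>
  A weighted form of the arithmetic-geometric mean inequality combined with Markov's: it takes the
  place of the Cauchy-Schwarz inequality for the product of an exponential and the indicator of
  \<open>\<bar>t - x\<bar> \<ge> \<delta>\<close>.
\<close>
lemma exp_growth_away_from_point:
  fixes x y :: real
  assumes "\<bar>y\<bar> \<le> C * E" "E \<ge> 0" "C \<ge> 0" "N > 0" "\<delta> > 0" "\<bar>t - x\<bar> \<ge> \<delta>"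
  shows "\<bar>y\<bar> \<le> C * (E\<^sup>2 / N + N * ((t - x) ^ (2 * m) / \<delta> ^ (2 * m)))"
proof -
  have "\<delta> ^ (2 * m) \<le> \<bar>t - x\<bar> ^ (2 * m)" using assms by (intro power_mono) auto
  hence "1 \<le> (t - x) ^ (2 * m) / \<delta> ^ (2 * m)"
    using assms by (simp add: power_even_abs)
  hence "N * 1 \<le> N * ((t - x) ^ (2 * m) / \<delta> ^ (2 * m))"
    using assms by (intro mult_left_mono) auto
  moreover have "E \<le> E\<^sup>2 / N + N"
  proof -
    have "0 \<le> (E - N)\<^sup>2 + E * N" using assms by simp
    hence "E * N \<le> E\<^sup>2 + N * N"
      by (simp add: power2_eq_square algebra_simps)
    thus ?thesis using assms by (simp add: field_simps)
  qed
  ultimately have "E \<le> E\<^sup>2 / N + N * ((t - x) ^ (2 * m) / \<delta> ^ (2 * m))" by linarith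
  hence "C * E \<le> C * (E\<^sup>2 / N + N * ((t - x) ^ (2 * m) / \<delta> ^ (2 * m)))"
    using assms by (intro mult_left_mono)
  thus ?thesis using assms(1) by linarith
qed

text \<open>
  The constant \<open>D\<close> depends on \<open>\<epsilon>\<close> and \<open>\<delta>\<close>, which is harmless because its power of \<open>n\<close> is one better
  than needed. The condition \<open>4Ax \<le> n\<close> bounds the mean of \<open>e\<^bsup>2AT\<^esup>\<close>.
\<close>
lemma post_widder_remainder:
  assumes "x > 0" "\<beta> \<ge> 0" "R \<in> exp_space_of A" "A > 0" "\<delta> > 0" "\<epsilon> > 0"
    and near: "\<And>t. \<bar>t - x\<bar> < \<delta> \<Longrightarrow> \<bar>R t\<bar> \<le> \<epsilon> * (t - x) ^ (2 * q)"
  obtains D where "\<And>n. n > 0 \<Longrightarrow> 4 * A * x \<le> real n \<Longrightarrow>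
    \<bar>post_widder \<beta> n R x\<bar> \<le> \<epsilon> * post_widder \<beta> n (\<lambda>t. (t - x) ^ (2 * q)) x + D / real n ^ Suc q"
proof -
  obtain C where C: "C > 0" "\<And>t. t \<ge> 0 \<Longrightarrow> \<bar>R t\<bar> \<le> C * exp (A * t)"
    using assms(3) by (rule exp_space_ofE) blast
  (* the moment of order 2m = 4q+4 is O(1/N^2) for N = n^(q+1) below; one factor N is lost *)
  define m where "m = 2 * Suc q"
  obtain M where M: "M \<ge> 0"
    "\<And>n. n > 0 \<Longrightarrow> post_widder \<beta> n (\<lambda>t. (t - x) ^ (2 * m)) x \<le> M / real n ^ m"
    using post_widder_even_moment_le[OF assms(1,2)] by blast
  define D where "D = C * (exp (4 * A * x + \<beta> * x) + M / \<delta> ^ (2 * m))"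
  show ?thesis
  proof (rule that[of D])
    fix n :: nat assume n: "n > 0" "4 * A * x \<le> real n"
    define N where "N = real n ^ Suc q"
    have N: "N > 0" using n by (simp add: N_def)
    have Ax: "2 * A * x < real n" using n assms mult_pos_pos[of A x] by linarith
    define g1 where "g1 = (\<lambda>t. \<epsilon> * (t - x) ^ (2 * q))"
    define g2 where "g2 = (\<lambda>t. C / N * exp (2 * A * t))"
    define g3 where "g3 = (\<lambda>t. C * N / \<delta> ^ (2 * m) * (t - x) ^ (2 * m))"
    have g: "g1 \<in> exp_space_of (2 * A)" "g2 \<in> exp_space_of (2 * A)" "g3 \<in> exp_space_of (2 * A)"
      unfolding g1_def g2_def g3_def using assms
      by (intro exp_space_of_cmult shifted_power_in_exp_space_of exp_in_exp_space_of; simp)+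
    have R: "R \<in> exp_space_of (2 * A)"
      using assms by (intro exp_space_of_mono[OF assms(3)]) auto
    have "\<bar>R t\<bar> \<le> g1 t + (g2 t + g3 t)" if "t \<ge> 0" for t
    proof (cases "\<bar>t - x\<bar> < \<delta>")
      case True
      have "g2 t \<ge> 0" "g3 t \<ge> 0"
        using C N assms by (auto simp: g2_def g3_def)
      thus ?thesis using near[OF True] by (simp add: g1_def)
    next
      case False
      have "\<bar>R t\<bar> \<le> C * ((exp (A * t))\<^sup>2 / N + N * ((t - x) ^ (2 * m) / \<delta> ^ (2 * m)))"
        using C N False assms that by (intro exp_growth_away_from_point) auto
      also have "(exp (A * t))\<^sup>2 = exp (2 * A * t)"
        by (simp add: mult.assoc flip: exp_double)
      finally have "\<bar>R t\<bar> \<le> g2 t + g3 t" by (simp add: g2_def g3_def algebra_simps)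
      moreover have "g1 t \<ge> 0" using assms by (simp add: g1_def)
      ultimately show ?thesis by simp
    qed
    hence "\<bar>post_widder \<beta> n R x\<bar> \<le> post_widder \<beta> n (\<lambda>t. g1 t + (g2 t + g3 t)) x"
      using g by (intro abs_post_widder_le[OF assms(1,2) n(1) Ax R] exp_space_of_add)
    also have "\<dots> = post_widder \<beta> n g1 x + (post_widder \<beta> n g2 x + post_widder \<beta> n g3 x)"
      using g by (simp add: post_widder_add[OF assms(1,2) n(1) Ax] exp_space_of_add)
    also have "post_widder \<beta> n g1 x = \<epsilon> * post_widder \<beta> n (\<lambda>t. (t - x) ^ (2 * q)) x"
      unfolding g1_def using assms
      by (intro post_widder_cmult[OF assms(1,2) n(1) Ax] shifted_power_in_exp_space_of) auto
    also have "post_widder \<beta> n g2 x = C / N * post_widder \<beta> n (\<lambda>t. exp (2 * A * t)) x"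
      unfolding g2_def by (intro post_widder_cmult[OF assms(1,2) n(1) Ax] exp_in_exp_space_of)
    also have "post_widder \<beta> n g3 x = C * N / \<delta> ^ (2 * m) * post_widder \<beta> n (\<lambda>t. (t - x) ^ (2 * m)) x"
      unfolding g3_def using assms
      by (intro post_widder_cmult[OF assms(1,2) n(1) Ax] shifted_power_in_exp_space_of) auto
    also have "C / N * post_widder \<beta> n (\<lambda>t. exp (2 * A * t)) x
        \<le> C / N * exp (4 * A * x + \<beta> * x)"
      using C N n assms post_widder_exp_le[OF assms(1,2), of "2 * A" n]
      by (intro mult_left_mono) auto
    also have "C * N / \<delta> ^ (2 * m) * post_widder \<beta> n (\<lambda>t. (t - x) ^ (2 * m)) x
        \<le> C * N / \<delta> ^ (2 * m) * (M / real n ^ m)"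
      using C N assms by (intro mult_left_mono M(2) n) auto
    also have "real n ^ m = N * N"
      by (simp add: N_def m_def mult_2 power_add)
    also have "C / N * exp (4 * A * x + \<beta> * x) + C * N / \<delta> ^ (2 * m) * (M / (N * N)) = D / N"
      using N by (simp add: D_def field_simps)
    finally show "\<bar>post_widder \<beta> n R x\<bar> \<le>
        \<epsilon> * post_widder \<beta> n (\<lambda>t. (t - x) ^ (2 * q)) x + D / real n ^ Suc q"
      by (simp add: N_def)
  qed
qed

theorem theorem1:
  fixes \<beta> x :: real and q :: nat and f :: "real \<Rightarrow> real"
  assumes "\<beta> \<ge> 0" and "q \<ge> 1" and "x > 0"
    and "f \<in> exp_space"
    and "has_nth_derivative_at (2 * q) f x"
  shows "(\<lambda>n. post_widder \<beta> n f x
            - (f x + (\<Sum>k = 1..q. 1 / real n ^ k * c_coeff \<beta> k f x)))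
         \<in> o(\<lambda>n. 1 / real n ^ q)"
proof (rule landau_o.smallI)
  fix c :: real assume c: "c > 0"
  obtain A where A: "A > 0" "f \<in> exp_space_of A"
    using assms(4) by (auto simp: exp_space_def)
  define T where "T = taylor_poly (2 * q) f x"
  define R where "R = (\<lambda>t. f t + (-1) * T t)"
  have T: "T \<in> exp_space_of A" unfolding T_def by (rule taylor_poly_in_exp_space_of) fact
  have R: "R \<in> exp_space_of A"
    unfolding R_def using A T by (intro exp_space_of_add exp_space_of_cmult)
  obtain M where M: "M \<ge> 0"
    "\<And>n. n > 0 \<Longrightarrow> post_widder \<beta> n (\<lambda>t. (t - x) ^ (2 * q)) x \<le> M / real n ^ q"
    using post_widder_even_moment_le[OF assms(3,1)] by blast
  (* the near part then takes at most half of c; M + 1 avoids division by zero *)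
  define \<epsilon> where "\<epsilon> = c / (2 * (M + 1))"
  have \<epsilon>: "\<epsilon> > 0" "\<epsilon> * M \<le> c / 2"
    using c M by (auto simp: \<epsilon>_def field_simps)
  obtain \<delta> where \<delta>: "\<delta> > 0"
    "\<And>t. \<bar>t - x\<bar> < \<delta> \<Longrightarrow> \<bar>f t - taylor_poly (2 * q) f x t\<bar> \<le> \<epsilon> * \<bar>t - x\<bar> ^ (2 * q)"
    using taylor_peano[of "2 * q - 1" f x \<epsilon>] assms(2,5) \<epsilon> by auto
  have near: "\<bar>R t\<bar> \<le> \<epsilon> * (t - x) ^ (2 * q)" if "\<bar>t - x\<bar> < \<delta>" for t
    using \<delta>(2)[OF that] by (simp add: R_def T_def power_even_abs)
  obtain D where D: "\<And>n. n > 0 \<Longrightarrow> 4 * A * x \<le> real n \<Longrightarrow>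
      \<bar>post_widder \<beta> n R x\<bar> \<le> \<epsilon> * post_widder \<beta> n (\<lambda>t. (t - x) ^ (2 * q)) x + D / real n ^ Suc q"
    using post_widder_remainder[OF assms(3,1) R A(1) \<delta>(1) \<epsilon>(1) near] by blast
  obtain D' where D': "\<And>n. n > 0 \<Longrightarrow>
      \<bar>post_widder \<beta> n T x - (f x + (\<Sum>k=1..q. 1 / real n ^ k * c_coeff \<beta> k f x))\<bar>
        \<le> D' / real n ^ Suc q"
    unfolding T_def using post_widder_taylor_poly[OF assms(3,1)] by blast
  have "\<forall>\<^sub>F n in sequentially. n > 0 \<and> 4 * A * x \<le> real n \<and> (D + D') / real n \<le> c / 2"
  proof (intro eventually_conj)
    show "\<forall>\<^sub>F n in sequentially. n > 0" by (rule eventually_gt_at_top)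
    show "\<forall>\<^sub>F n in sequentially. 4 * A * x \<le> real n"
      using filterlim_real_sequentially by (simp add: filterlim_at_top)
    have "(\<lambda>n. (D + D') / real n) \<longlonglongrightarrow> 0"
      by (rule lim_const_over_n)
    hence "\<forall>\<^sub>F n in sequentially. (D + D') / real n < c / 2"
      using c by (intro order_tendstoD) auto
    thus "\<forall>\<^sub>F n in sequentially. (D + D') / real n \<le> c / 2"
      by eventually_elim simp
  qed
  thus "\<forall>\<^sub>F n in sequentially.
      norm (post_widder \<beta> n f x - (f x + (\<Sum>k = 1..q. 1 / real n ^ k * c_coeff \<beta> k f x)))
        \<le> c * norm (1 / real n ^ q)"
  proof eventually_elim
    case (elim n)
    hence n: "n > 0" "4 * A * x \<le> real n" "(D + D') / real n \<le> c / 2" by auto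
    have Ax: "A * x < real n" using n A assms mult_pos_pos[of A x] by linarith
    have "post_widder \<beta> n R x = post_widder \<beta> n f x - post_widder \<beta> n T x"
      unfolding R_def
      using post_widder_add[OF assms(3,1) n(1) Ax A(2) exp_space_of_cmult[OF T, of "-1"]]
        post_widder_cmult[OF assms(3,1) n(1) Ax T, of "-1"] by simp
    hence "\<bar>post_widder \<beta> n f x - (f x + (\<Sum>k = 1..q. 1 / real n ^ k * c_coeff \<beta> k f x))\<bar>
        \<le> \<epsilon> * post_widder \<beta> n (\<lambda>t. (t - x) ^ (2 * q)) x + D / real n ^ Suc q + D' / real n ^ Suc q"
      using D[OF n(1,2)] D'[OF n(1)] by linarith
    also have "\<dots> \<le> \<epsilon> * (M / real n ^ q) + D / real n ^ Suc q + D' / real n ^ Suc q"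
      using \<epsilon> M(2)[OF n(1)] by (intro add_right_mono mult_left_mono) auto
    also have "\<dots> = (\<epsilon> * M + (D + D') / real n) / real n ^ q"
      using n by (simp add: field_simps)
    also have "\<dots> \<le> c / real n ^ q"
      using add_mono[OF \<epsilon>(2) n(3)] by (intro divide_right_mono) simp_all
    finally show ?case using c by simp
  qed
qed

end
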